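(* Let $\mathbf{W}=\{\mathbf{W}(t):t\ge 0\}$ be standard planar Brownian motion started at the origin, let $\mathrm{H}=\operatorname{conv}\{\mathbf{W}(s):s\in[0,1]\}$, and let $\mathsf{R}$ be the circumradius of $\mathrm{H}$. Then $$\mathbb{E}[\mathsf{R}]\le \Gamma(1/2)^{-1}\int_0^\infty \frac{t^{-1/2}}{I_0(\sqrt{2t})}\,dt\approx 1.662180,$$ where $I_\nu(x)$ denotes the modified Bessel function of the first kind of order $\nu$.
   Context: Standard planar Brownian motion is $\mathbf{W}(t)=(W_1(t),W_2(t))$ with $W_1,W_2$ independent one-dimensional standard Brownian motions started at $0$. $\operatorname{conv}A$ is the convex hull of $A\subset\mathbb{R}^2$. The circumradius of a bounded set is the radius of the smallest disk containing it. The symbol $\approx$ only indicates a numerical approximation of the exact expression. *)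

theory Defs
  imports "HOL-Probability.Probability"
begin

text \<open>
  As usual, the initial condition and the continuity of the paths are only required almost surely.
  The second argument of \<^const>\<open>normal_density\<close> is the standard deviation.
\<close>

locale standard_brownian_motion = prob_space M
  for M :: "'a measure" +
  fixes B :: "real \<Rightarrow> 'a \<Rightarrow> real"
  assumes random_variable: "\<And>t. 0 \<le> t \<Longrightarrow> B t \<in> borel_measurable M"
    and start_zero: "AE \<omega> in M. B 0 \<omega> = 0"
    and gaussian_increments:
      "\<And>s t. 0 \<le> s \<Longrightarrow> s < t \<Longrightarrow>
        distributed M lborel (\<lambda>\<omega>. B t \<omega> - B s \<omega>) (normal_density 0 (sqrt (t - s)))"
    and indep_increments:
      "\<And>(n :: nat) (\<tau> :: nat \<Rightarrow> real). 0 \<le> \<tau> 0 \<Longrightarrow> (\<And>i. i < n \<Longrightarrow> \<tau> i < \<tau> (Suc i)) \<Longrightarrow>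
        indep_vars (\<lambda>_. borel) (\<lambda>i \<omega>. B (\<tau> (Suc i)) \<omega> - B (\<tau> i) \<omega>) {..<n}"
    and continuous_paths: "AE \<omega> in M. continuous_on {0..} (\<lambda>t. B t \<omega>)"

text \<open>
  The two coordinates are independent as processes, i.e. as random elements of the product space
  indexed by all times \<open>t \<ge> 0\<close>.
\<close>

locale planar_brownian_motion =
  X: standard_brownian_motion M "\<lambda>t \<omega>. W t \<omega> $ 1" +
  Y: standard_brownian_motion M "\<lambda>t \<omega>. W t \<omega> $ 2"
  for M :: "'a measure" and W :: "real \<Rightarrow> 'a \<Rightarrow> real^2" +
  assumes indep_coordinates:
    "X.indep_var
      (\<Pi>\<^sub>M t\<in>{0..}. borel) (\<lambda>\<omega>. \<lambda>t\<in>{0..}. W t \<omega> $ 1)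
      (\<Pi>\<^sub>M t\<in>{0..}. borel) (\<lambda>\<omega>. \<lambda>t\<in>{0..}. W t \<omega> $ 2)"

definition circumradius :: "'a::metric_space set \<Rightarrow> real" where
  "circumradius A = Inf {r. 0 \<le> r \<and> (\<exists>c. A \<subseteq> cball c r)}"

text \<open>
  For bounded sets the infimum is attained, so this is the radius of a smallest enclosing ball.
\<close>

lemma circumradius_attained:
  fixes A :: "'a::euclidean_space set"
  assumes "bounded A" "A \<noteq> {}"
  shows "\<exists>c. A \<subseteq> cball c (circumradius A)"
proof -
  let ?S = "{r. 0 \<le> r \<and> (\<exists>c. A \<subseteq> cball c r)}"
  obtain c0 r0 where "A \<subseteq> cball c0 r0" using assms(1) bounded_subset_cball by blast
  then have "A \<subseteq> cball c0 (max 0 r0)" by auto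
  then have ne: "?S \<noteq> {}" by (auto intro!: exI[of _ "max 0 r0"])
  have bdd: "bdd_below ?S" by (rule bdd_belowI[of _ 0]) auto
  have "\<exists>c. A \<subseteq> cball c (circumradius A + 1 / real (Suc n))" for n
  proof -
    have "Inf ?S < circumradius A + 1 / real (Suc n)" by (simp add: circumradius_def)
    then obtain r where "r \<in> ?S" "r < circumradius A + 1 / real (Suc n)"
      using cInf_lessD[OF ne] by blast
    then obtain c where "A \<subseteq> cball c r" by auto
    then show ?thesis using \<open>r < _\<close> by (intro exI[of _ c]) (meson order_trans less_imp_le subset_cball)
  qed
  then obtain c where c: "\<And>n. A \<subseteq> cball (c n) (circumradius A + 1 / real (Suc n))" by metis
  obtain a where a: "a \<in> A" using assms(2) by blast
  have "c n \<in> cball a (circumradius A + 1)" for n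
  proof -
    have "dist (c n) a \<le> circumradius A + 1 / real (Suc n)" using c[of n] a by auto
    also have "\<dots> \<le> circumradius A + 1" by simp
    finally show ?thesis by (simp add: dist_commute)
  qed
  then obtain l \<sigma> where l: "strict_mono (\<sigma> :: nat \<Rightarrow> nat)" "(c \<circ> \<sigma>) \<longlonglongrightarrow> l"
    using compact_cball[of a "circumradius A + 1", unfolded compact_def] by blast
  have "dist l x \<le> circumradius A" if "x \<in> A" for x
  proof (rule LIMSEQ_le)
    show "(\<lambda>n. dist ((c \<circ> \<sigma>) n) x) \<longlonglongrightarrow> dist l x" by (intro tendsto_intros l)
    have "(\<lambda>n. circumradius A + 1 / real (Suc n)) \<longlonglongrightarrow> circumradius A + 0"
      by (intro tendsto_intros LIMSEQ_Suc[OF lim_1_over_n])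
    from LIMSEQ_subseq_LIMSEQ[OF this l(1)]
    show "(\<lambda>n. circumradius A + 1 / real (Suc (\<sigma> n))) \<longlonglongrightarrow> circumradius A" by (simp add: o_def)
    show "\<exists>N. \<forall>n\<ge>N. dist ((c \<circ> \<sigma>) n) x \<le> circumradius A + 1 / real (Suc (\<sigma> n))"
      using subsetD[OF c that] by simp
  qed
  then show ?thesis by (intro exI[of _ l]) auto
qed

text \<open>
  The series \<open>I\<^sub>\<nu>(x) = (x/2)\<^sup>\<nu> \<Sum>\<^sub>m (x/2)\<^sup>2\<^sup>m / (m! \<Gamma>(\<nu> + m + 1))\<close> for real \<open>\<nu>\<close> and \<open>x \<ge> 0\<close>.
  The case distinction is needed because \<open>0 powr 0 = 0\<close> in the library, whereas \<open>I\<^sub>0(0) = 1\<close>.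
  The entire function \<^const>\<open>rGamma\<close> is the reciprocal of \<^const>\<open>Gamma\<close>.
\<close>

definition bessel_I :: "real \<Rightarrow> real \<Rightarrow> real" where
  "bessel_I \<nu> x = (if \<nu> = 0 then 1 else (x / 2) powr \<nu>) *
     (\<Sum>m. (x / 2) ^ (2 * m) * rGamma (\<nu> + real m + 1) / fact m)"

lemma bessel_I_0: "bessel_I 0 x = (\<Sum>m. (x / 2) ^ (2 * m) / (fact m)\<^sup>2)"
proof -
  have "rGamma (real m + 1) = 1 / fact m" for m
    by (simp add: rGamma_inverse_Gamma Gamma_fact add.commute inverse_eq_divide)
  then show ?thesis by (simp add: bessel_I_def power2_eq_square)
qed

end

theory Submission
  imports Defs "HOL-Real_Asymp.Real_Asymp"
begin

text \<open>
  The circumradius of the hull is at most \<open>max\<^sub>s |W(s)|\<close>, and by Fatou its expectation is at most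
  the lower limit of \<open>d\<^sub>n / \<surd>n\<close>, where \<open>d\<^sub>n\<close> is the expected maximal norm of an \<open>n\<close>-step walk with
  standard Gaussian steps in the plane: Brownian scaling turns every grid into the same walk.

  The function \<open>z \<mapsto> I\<^sub>0(\<lambda>|z|)\<close>, an average of exponentials \<open>exp(\<lambda> z \<cdot> e)\<close> over unit vectors \<open>e\<close>, is
  multiplied by \<open>exp(\<lambda>\<^sup>2/2)\<close> under a Gaussian step. Hence, with \<open>q = exp(-\<lambda>\<^sup>2/2)\<close>, the generating
  function \<open>(1-q) \<Sum> q\<^sup>n P(max\<^sub>k\<^sub>\<le>\<^sub>n |S\<^sub>k| \<ge> r)\<close> is at most \<open>1 / I\<^sub>0(\<lambda>r)\<close>; this is the Laplace transform
  bound for the exit time, with no stopping times needed. Integrating over \<open>r\<close> bounds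
  \<open>(1-q) \<Sum> q\<^sup>n d\<^sub>n\<close> by \<open>K/\<lambda>\<close> with \<open>K = \<integral> dr / I\<^sub>0(r)\<close>. If \<open>d\<^sub>n \<ge> c \<surd>n\<close> eventually, comparing with
  the Gamma integral as \<open>\<lambda> \<rightarrow> 0\<close> gives \<open>c \<Gamma>(1/2) \<le> \<surd>2 K\<close>, and the substitution \<open>t = r\<^sup>2/2\<close> identifies
  \<open>\<surd>2 K\<close> with the integral of the theorem.
\<close>

section \<open>The Bessel function and Gaussian averages\<close>

lemma summable_bessel_I_0_series: "summable (\<lambda>m. (x / 2) ^ (2 * m) / (fact m)\<^sup>2 :: real)"
proof (rule summable_comparison_test')
  show "summable (\<lambda>m. ((x / 2)\<^sup>2) ^ m /\<^sub>R fact m)"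
    by (rule summable_exp_generic)
next
  fix m :: nat
  have "(x / 2) ^ (2 * m) / (fact m)\<^sup>2 \<le> (x / 2) ^ (2 * m) / fact m"
    by (intro divide_left_mono) (auto simp: power2_eq_square)
  then show "norm ((x / 2) ^ (2 * m) / (fact m)\<^sup>2) \<le> ((x / 2)\<^sup>2) ^ m /\<^sub>R fact m"
    by (simp only: power_mult real_scaleR_def divide_inverse mult.commute[of _ "inverse _"]) simp
qed

lemma bessel_I_0_partial_sum_le: "(\<Sum>m<n. (x / 2) ^ (2 * m) / (fact m)\<^sup>2) \<le> bessel_I 0 x"
  unfolding bessel_I_0 by (rule sum_le_suminf[OF summable_bessel_I_0_series]) auto

text \<open>The first two terms of the series. This much growth already makes \<open>1 / I_0\<close>
  integrable on the half-line.\<close>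

lemma bessel_I_0_ge_quadratic: "1 + x\<^sup>2 / 4 \<le> bessel_I 0 x"
  using bessel_I_0_partial_sum_le[of x 2] by (simp add: eval_nat_numeral)

lemma bessel_I_0_pos: "0 < bessel_I 0 x"
  by (rule less_le_trans[OF _ bessel_I_0_ge_quadratic]) (simp add: add_pos_nonneg)

lemma bessel_I_0_mono: "0 \<le> x \<Longrightarrow> x \<le> y \<Longrightarrow> bessel_I 0 x \<le> bessel_I 0 y"
  unfolding bessel_I_0
  by (intro suminf_le summable_bessel_I_0_series divide_right_mono power_mono) auto

text \<open>The series is an everywhere convergent power series in \<open>(x / 2)^2\<close>.\<close>

lemma isCont_bessel_I_0: "isCont (bessel_I 0) x"
proof -
  have "isCont (\<lambda>y. \<Sum>m. (1 / (fact m)\<^sup>2) * y ^ m :: real) ((x / 2)\<^sup>2)"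
  proof (rule isCont_powser_converges_everywhere)
    fix y :: real
    have "summable (\<lambda>m. 1 / (fact m)\<^sup>2 * \<bar>y\<bar> ^ m :: real)"
      \<comment> \<open>This argument is chosen so that its half squares to
        \<open>\<bar>y\<bar>\<close>.\<close>
      using summable_bessel_I_0_series[of "2 * sqrt \<bar>y\<bar>"] by (simp add: power_mult)
    then have "summable (\<lambda>m. norm (1 / (fact m)\<^sup>2 * y ^ m :: real))"
      by (simp add: norm_mult power_abs)
    then show "summable (\<lambda>m. 1 / (fact m)\<^sup>2 * y ^ m :: real)"
      by (rule summable_norm_cancel)
  qed
  moreover have "isCont (\<lambda>x. (x / 2)\<^sup>2) x"
    by (intro continuous_intros) simp
  ultimately have "isCont (\<lambda>x. \<Sum>m. (1 / (fact m)\<^sup>2) * ((x / 2)\<^sup>2) ^ m :: real) x"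
    by (rule isCont_o2[rotated])
  moreover have "bessel_I 0 = (\<lambda>x. \<Sum>m. (1 / (fact m)\<^sup>2) * ((x / 2)\<^sup>2) ^ m :: real)"
    unfolding bessel_I_0 power_mult by (simp only: divide_inverse mult_1_left mult.commute)
  ultimately show ?thesis by simp
qed

lemma borel_measurable_bessel_I_0 [measurable]: "bessel_I 0 \<in> borel_measurable borel"
  by (intro borel_measurable_continuous_onI continuous_at_imp_continuous_on ballI isCont_bessel_I_0)

text \<open>
  With \<open>c = x cos t + y sin t\<close> and its derivative \<open>s\<close> one has \<open>c\<^sup>2 + s\<^sup>2 = x\<^sup>2 + y\<^sup>2\<close>, so integrating the
  derivative of the periodic function \<open>c\<^sup>2\<^sup>m\<^sup>+\<^sup>1 s\<close> gives the recursion in \<open>m\<close>.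
\<close>

lemma has_integral_trig_power:
  "((\<lambda>t. (x * cos t + y * sin t) ^ (2 * m)) has_integral
    2 * pi * (fact (2 * m) * (x\<^sup>2 + y\<^sup>2) ^ m / (4 ^ m * (fact m)\<^sup>2))) {0..2 * pi}"
proof (induction m)
  case 0
  then show ?case using has_integral_const_real[of "1 :: real" 0 "2 * pi"] by simp
next
  case (Suc m)
  let ?c = "\<lambda>t. x * cos t + y * sin t" and ?s = "\<lambda>t. - x * sin t + y * cos t"
  have s2: "(?s t)\<^sup>2 = x\<^sup>2 + y\<^sup>2 - (?c t)\<^sup>2" for t
  proof -
    have "(?s t)\<^sup>2 + (?c t)\<^sup>2 = (x\<^sup>2 + y\<^sup>2) * ((sin t)\<^sup>2 + (cos t)\<^sup>2)"
      by (simp only: power2_eq_square) algebra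
    then show ?thesis by simp
  qed
  have "((\<lambda>t. real (2 * m + 1) * ?c t ^ (2 * m) * ?s t * ?s t + ?c t ^ (2 * m + 1) * (- ?c t)) has_integral
      ?c (2 * pi) ^ (2 * m + 1) * ?s (2 * pi) - ?c 0 ^ (2 * m + 1) * ?s 0) {0..2 * pi}"
  proof (rule fundamental_theorem_of_calculus)
    fix t
    have exponent: "2 * m + 1 - Suc 0 = 2 * m" by simp
    have c: "(?c has_real_derivative ?s t) (at t within {0..2 * pi})"
      by (rule derivative_eq_intros refl)+ simp
    have s: "(?s has_real_derivative - ?c t) (at t within {0..2 * pi})"
      by (rule derivative_eq_intros refl)+ simp
    have "((\<lambda>t. ?c t ^ (2 * m + 1) * ?s t) has_real_derivative
        (real (2 * m + 1) * (?s t * ?c t ^ (2 * m + 1 - Suc 0))) * ?s t + - ?c t * ?c t ^ (2 * m + 1))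
        (at t within {0..2 * pi})"
      by (rule DERIV_mult[OF DERIV_power[OF c] s])
    also have "(real (2 * m + 1) * (?s t * ?c t ^ (2 * m + 1 - Suc 0))) * ?s t + - ?c t * ?c t ^ (2 * m + 1) =
        real (2 * m + 1) * ?c t ^ (2 * m) * ?s t * ?s t + ?c t ^ (2 * m + 1) * (- ?c t)"
      unfolding exponent by (simp only: ac_simps)
    finally show "((\<lambda>t. ?c t ^ (2 * m + 1) * ?s t) has_vector_derivative
        real (2 * m + 1) * ?c t ^ (2 * m) * ?s t * ?s t + ?c t ^ (2 * m + 1) * (- ?c t))
        (at t within {0..2 * pi})"
      by (simp only: has_real_derivative_iff_has_vector_derivative)
  qed simp
  moreover have "real (2 * m + 1) * ?c t ^ (2 * m) * ?s t * ?s t + ?c t ^ (2 * m + 1) * (- ?c t) =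
      real (2 * m + 1) * (x\<^sup>2 + y\<^sup>2) * ?c t ^ (2 * m) - real (2 * m + 2) * ?c t ^ (2 * Suc m)" for t
  proof -
    have "real (2 * m + 1) * ?c t ^ (2 * m) * ?s t * ?s t =
        real (2 * m + 1) * ?c t ^ (2 * m) * (?s t)\<^sup>2"
      by (simp only: power2_eq_square mult.assoc)
    also have "\<dots> = real (2 * m + 1) * (x\<^sup>2 + y\<^sup>2) * ?c t ^ (2 * m) - real (2 * m + 1) * (?c t ^ (2 * m) * (?c t)\<^sup>2)"
      unfolding s2 by (simp only: right_diff_distrib) (simp only: ac_simps)
    finally show ?thesis
      by (simp add: power2_eq_square algebra_simps)
  qed
  ultimately have "((\<lambda>t. real (2 * m + 1) * (x\<^sup>2 + y\<^sup>2) * ?c t ^ (2 * m)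
      - real (2 * m + 2) * ?c t ^ (2 * Suc m)) has_integral 0) {0..2 * pi}"
    by simp
  \<comment> \<open>Subtracting the vanishing integral from a multiple of the induction hypothesis
    isolates the next even power.\<close>
  from has_integral_diff[OF has_integral_mult_right[OF Suc, of "real (2 * m + 1) * (x\<^sup>2 + y\<^sup>2)"] this]
  have "((\<lambda>t. real (2 * m + 2) * ?c t ^ (2 * Suc m)) has_integral real (2 * m + 1) * (x\<^sup>2 + y\<^sup>2) *
      (2 * pi * (fact (2 * m) * (x\<^sup>2 + y\<^sup>2) ^ m / (4 ^ m * (fact m)\<^sup>2)))) {0..2 * pi}"
    by simp
  from has_integral_divide[OF this, of "real (2 * m + 2)"]
  have "((\<lambda>t. ?c t ^ (2 * Suc m)) has_integral real (2 * m + 1) * (x\<^sup>2 + y\<^sup>2) *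
      (2 * pi * (fact (2 * m) * (x\<^sup>2 + y\<^sup>2) ^ m / (4 ^ m * (fact m)\<^sup>2))) / real (2 * m + 2)) {0..2 * pi}"
    by (simp del: of_nat_add)
  also have "real (2 * m + 1) * (x\<^sup>2 + y\<^sup>2) *
      (2 * pi * (fact (2 * m) * (x\<^sup>2 + y\<^sup>2) ^ m / (4 ^ m * (fact m)\<^sup>2))) / real (2 * m + 2) =
      2 * pi * (fact (2 * Suc m) * (x\<^sup>2 + y\<^sup>2) ^ Suc m / (4 ^ Suc m * (fact (Suc m))\<^sup>2))"
  proof -
    \<comment> \<open>The closed form passes from \<open>m\<close> to \<open>m + 1\<close>; here
      \<open>M\<close>, \<open>Q\<close>, \<open>F\<close>, \<open>G\<close> stand for m, 4^m,
      (2m)!, m!, and \<open>p\<close>, \<open>P\<close> for x^2 + y^2 and its m-th power.\<close>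
    have alg: "(2 * M + 1) * p * (2 * pi * (F * P / (Q * G\<^sup>2))) / (2 * M + 2) =
        2 * pi * ((2 * M + 2) * ((2 * M + 1) * F) * (p * P) / (4 * Q * ((M + 1) * G)\<^sup>2))"
      if "M \<ge> 0" "Q \<noteq> 0" "G \<noteq> 0" for M p F P Q G :: real
    proof -
      have M: "2 * M + 2 = 2 * (M + 1)" by simp
      have "M + 1 \<noteq> 0" using that by simp
      then show ?thesis using that(2,3) unfolding M power_mult_distrib
        by (simp add: divide_simps) (simp add: power2_eq_square algebra_simps)
    qed
    have "fact (2 * Suc m) = (2 * real m + 2) * ((2 * real m + 1) * fact (2 * m))"
      by (simp add: algebra_simps)
    moreover have "fact (Suc m) = (real m + 1) * fact m" by simp
    moreover have "real (2 * m + 1) = 2 * real m + 1" "real (2 * m + 2) = 2 * real m + 2" by simp_all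
    ultimately show ?thesis
      using alg[of "real m" "4 ^ m" "fact m" "x\<^sup>2 + y\<^sup>2" "fact (2 * m)" "(x\<^sup>2 + y\<^sup>2) ^ m"]
      by (simp only: power_Suc) simp
  qed
  finally show ?case .
qed

section \<open>Averages of cosh over the circle\<close>

text \<open>The Taylor series of cosh has only even powers, so no omitted term is negative.\<close>

lemma cosh_ge_partial_sum: "(\<Sum>m<n. c ^ (2 * m) / fact (2 * m)) \<le> cosh (c :: real)"
proof -
  have "(\<lambda>m. if even m then c ^ m /\<^sub>R fact m else 0) sums cosh c"
    by (rule cosh_converges)
  then have s: "(\<lambda>m. if even m then c ^ m / fact m else 0) sums cosh c"
    by (simp only: real_scaleR_def divide_inverse mult.commute)
  have "(\<Sum>m<n. c ^ (2 * m) / fact (2 * m)) = (\<Sum>m\<in>(*) 2 ` {..<n}. if even m then c ^ m / fact m else 0)"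
    by (subst sum.reindex) (auto simp: inj_on_def)
  also have "\<dots> \<le> (\<Sum>m. if even m then c ^ m / fact m else 0)"
    using s by (intro sum_le_suminf) (auto simp: sums_iff zero_le_even_power)
  finally show ?thesis using s by (simp add: sums_iff)
qed

lemma borel_measurable_cosh [measurable]: "(cosh :: real \<Rightarrow> real) \<in> borel_measurable borel"
  by (intro borel_measurable_continuous_onI continuous_intros)

text \<open>
  This equals \<open>I\<^sub>0(|(x, y)|)\<close>, but only the lower bound by \<open>I\<^sub>0\<close> is needed. Using \<open>cosh\<close> instead of \<open>exp\<close>
  removes the odd powers, which integrate to \<open>0\<close>.
\<close>

definition circle_avg :: "real \<Rightarrow> real \<Rightarrow> ennreal" where
  "circle_avg x y =
    (\<integral>\<^sup>+t. indicator {0..2 * pi} t * ennreal (cosh (x * cos t + y * sin t) / (2 * pi)) \<partial>lborel)"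

lemma circle_avg_0: "circle_avg 0 0 = 1"
proof -
  have "circle_avg 0 0 = ennreal (1 / (2 * pi)) * (\<integral>\<^sup>+t. indicator {0..2 * pi} t \<partial>lborel)"
    unfolding circle_avg_def by (subst nn_integral_cmult[symmetric]) (simp_all add: mult.commute)
  also have "\<dots> = ennreal (1 / (2 * pi)) * ennreal (2 * pi)"
    by (subst nn_integral_indicator) (simp_all add: emeasure_lborel_Icc)
  also have "\<dots> = 1"
    by (subst ennreal_mult[symmetric]) auto
  finally show ?thesis .
qed

text \<open>Integrating the truncated cosh series over the circle gives exactly the truncated series
  of \<open>I_0\<close>; then let the truncation tend to infinity.\<close>

lemma bessel_I_0_le_circle_avg: "ennreal (bessel_I 0 (sqrt (x\<^sup>2 + y\<^sup>2))) \<le> circle_avg x y"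
proof -
  let ?r = "sqrt (x\<^sup>2 + y\<^sup>2)"
  have bound: "ennreal (\<Sum>m<n. (?r / 2) ^ (2 * m) / (fact m)\<^sup>2) \<le> circle_avg x y" for n
  proof -
    let ?f = "\<lambda>t. \<Sum>m<n. (x * cos t + y * sin t) ^ (2 * m) / fact (2 * m) / (2 * pi)"
    have "(?f has_integral (\<Sum>m<n. 2 * pi * (fact (2 * m) * (x\<^sup>2 + y\<^sup>2) ^ m / (4 ^ m * (fact m)\<^sup>2))
        / fact (2 * m) / (2 * pi))) {0..2 * pi}"
      by (intro has_integral_sum has_integral_divide has_integral_trig_power) auto
    also have "(\<Sum>m<n. 2 * pi * (fact (2 * m) * (x\<^sup>2 + y\<^sup>2) ^ m / (4 ^ m * (fact m)\<^sup>2))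
        / fact (2 * m) / (2 * pi)) = (\<Sum>m<n. (?r / 2) ^ (2 * m) / (fact m)\<^sup>2)"
      by (intro sum.cong refl) (simp add: power_mult power_divide)
    finally have *: "(?f has_integral (\<Sum>m<n. (?r / 2) ^ (2 * m) / (fact m)\<^sup>2)) {0..2 * pi}" .
    have "(\<integral>\<^sup>+t. ennreal (indicator {0..2 * pi} t * ?f t) \<partial>lborel) =
        ennreal (\<Sum>m<n. (?r / 2) ^ (2 * m) / (fact m)\<^sup>2)"
      by (rule nn_integral_has_integral_lebesgue[OF _ *]) (intro sum_nonneg divide_nonneg_nonneg; simp)
    moreover have "(\<integral>\<^sup>+t. ennreal (indicator {0..2 * pi} t * ?f t) \<partial>lborel) \<le> circle_avg x y"
      unfolding circle_avg_def
    proof (rule nn_integral_mono)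
      fix t :: real
      have "?f t \<le> cosh (x * cos t + y * sin t) / (2 * pi)"
        using cosh_ge_partial_sum[of "x * cos t + y * sin t" n]
        unfolding sum_divide_distrib[symmetric] by (intro divide_right_mono) auto
      then show "ennreal (indicator {0..2 * pi} t * ?f t) \<le>
          indicator {0..2 * pi} t * ennreal (cosh (x * cos t + y * sin t) / (2 * pi))"
        by (cases "t \<in> {0..2 * pi}") (simp_all add: ennreal_leI)
    qed
    ultimately show ?thesis by simp
  qed
  have "(\<lambda>n. ennreal (\<Sum>m<n. (?r / 2) ^ (2 * m) / (fact m)\<^sup>2)) \<longlonglongrightarrow> ennreal (bessel_I 0 ?r)"
    unfolding bessel_I_0
    using summable_LIMSEQ[OF summable_bessel_I_0_series[of ?r]] by (intro tendsto_ennrealI)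
  then show ?thesis
    by (rule LIMSEQ_le_const2) (auto intro!: bound)
qed

section \<open>Gaussian averages of exponentials and of the circle average\<close>

abbreviation std_gauss :: "real measure" where
  "std_gauss \<equiv> density lborel std_normal_density"

text \<open>Completing the square: tilting the standard density by \<open>exp (c * a)\<close> yields
  \<open>exp (c^2 / 2)\<close> times the density with mean \<open>c\<close>.\<close>

lemma nn_integral_std_gauss_exp: "(\<integral>\<^sup>+a. ennreal (exp (c * a)) \<partial>std_gauss) = ennreal (exp (c\<^sup>2 / 2))"
proof -
  have "(\<integral>\<^sup>+a. ennreal (exp (c * a)) \<partial>std_gauss)
      = (\<integral>\<^sup>+a. ennreal (exp (c\<^sup>2 / 2)) * ennreal (normal_density c 1 a) \<partial>lborel)"
  proof (subst nn_integral_density, (measurable)[2], rule nn_integral_cong)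
    fix a :: real
    have "exp (- a\<^sup>2 / 2) * exp (c * a) = exp (c\<^sup>2 / 2) * exp (- (a - c)\<^sup>2 / 2)"
      unfolding exp_add[symmetric] by (simp add: power2_eq_square field_simps)
    then have "std_normal_density a * exp (c * a) = exp (c\<^sup>2 / 2) * normal_density c 1 a"
      by (simp add: normal_density_def)
    then show "ennreal (std_normal_density a) * ennreal (exp (c * a)) =
        ennreal (exp (c\<^sup>2 / 2)) * ennreal (normal_density c 1 a)"
      by (simp add: ennreal_mult[symmetric])
  qed
  also have "\<dots> = ennreal (exp (c\<^sup>2 / 2)) * (\<integral>\<^sup>+a. ennreal (normal_density c 1 a) \<partial>lborel)"
    by (rule nn_integral_cmult) auto
  also have "(\<integral>\<^sup>+a. ennreal (normal_density c 1 a) \<partial>lborel) = 1"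
    using prob_space.emeasure_space_1[OF prob_space_normal_density, of 1 c]
    by (simp add: emeasure_density)
  finally show ?thesis by simp
qed

interpretation std_gauss: prob_space std_gauss
  by (rule prob_space_normal_density) simp

lemma nn_integral_std_gauss_pair_exp:
  "(\<integral>\<^sup>+a. \<integral>\<^sup>+b. ennreal (exp (u * a + v * b + w)) \<partial>std_gauss \<partial>std_gauss) =
    ennreal (exp ((u\<^sup>2 + v\<^sup>2) / 2) * exp w)"
proof -
  have "(\<integral>\<^sup>+a. \<integral>\<^sup>+b. ennreal (exp (u * a + v * b + w)) \<partial>std_gauss \<partial>std_gauss) =
      (\<integral>\<^sup>+a. \<integral>\<^sup>+b. ennreal (exp (u * a)) * ennreal (exp w) * ennreal (exp (v * b)) \<partial>std_gauss \<partial>std_gauss)"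
    by (intro nn_integral_cong) (simp add: exp_add ac_simps flip: ennreal_mult)
  also have "\<dots> = (\<integral>\<^sup>+a. ennreal (exp (u * a)) * ennreal (exp w * exp (v\<^sup>2 / 2)) \<partial>std_gauss)"
    by (intro nn_integral_cong, subst nn_integral_cmult)
       (auto simp: nn_integral_std_gauss_exp mult.assoc simp flip: ennreal_mult)
  also have "\<dots> = ennreal (exp ((u\<^sup>2 + v\<^sup>2) / 2) * exp w)"
    by (subst nn_integral_multc, measurable, unfold nn_integral_std_gauss_exp)
       (auto simp: exp_add add_divide_distrib ac_simps simp flip: ennreal_mult)
  finally show ?thesis .
qed

text \<open>By Fubini the Gaussian average can be taken for each direction separately. It multiplies
  each exponential by \<open>exp (l^2 / 2)\<close>, independently of the direction because cos^2 +
  sin^2 = 1.\<close>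

lemma circle_avg_heat:
  "(\<integral>\<^sup>+a. \<integral>\<^sup>+b. circle_avg (l * (x + a)) (l * (y + b)) \<partial>std_gauss \<partial>std_gauss) =
    ennreal (exp (l\<^sup>2 / 2)) * circle_avg (l * x) (l * y)"
proof -
  interpret pair_sigma_finite std_gauss lborel ..
  let ?g = "\<lambda>t a b. ennreal (cosh (l * (x + a) * cos t + l * (y + b) * sin t) / (2 * pi))"
  have inner: "(\<integral>\<^sup>+a. \<integral>\<^sup>+b. ?g t a b \<partial>std_gauss \<partial>std_gauss) =
      ennreal (exp (l\<^sup>2 / 2)) * ennreal (cosh (l * x * cos t + l * y * sin t) / (2 * pi))" for t
  proof -
    let ?w = "l * x * cos t + l * y * sin t" and ?u = "l * cos t" and ?v = "l * sin t"
    have uv: "(l * cos t)\<^sup>2 + (l * sin t)\<^sup>2 = l\<^sup>2"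
      by (simp add: power_mult_distrib flip: distrib_left)
    \<comment> \<open>The two exponentials of cosh are treated alike, with (u, v, w) and (-u, -v,
      -w).\<close>
    have "(\<integral>\<^sup>+a. \<integral>\<^sup>+b. ?g t a b \<partial>std_gauss \<partial>std_gauss) =
        (\<integral>\<^sup>+a. \<integral>\<^sup>+b. ennreal (1 / (4 * pi)) * (ennreal (exp (?u * a + ?v * b + ?w)) +
          ennreal (exp ((- ?u) * a + (- ?v) * b + (- ?w)))) \<partial>std_gauss \<partial>std_gauss)"
      by (intro nn_integral_cong)
         (simp add: cosh_def field_simps flip: ennreal_mult ennreal_plus)
    also have "\<dots> = ennreal (1 / (4 * pi)) *
        ((\<integral>\<^sup>+a. \<integral>\<^sup>+b. ennreal (exp (?u * a + ?v * b + ?w)) \<partial>std_gauss \<partial>std_gauss) +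
         (\<integral>\<^sup>+a. \<integral>\<^sup>+b. ennreal (exp ((- ?u) * a + (- ?v) * b + (- ?w))) \<partial>std_gauss \<partial>std_gauss))"
      by (simp add: nn_integral_cmult nn_integral_add)
    also have "\<dots> = ennreal (1 / (4 * pi)) *
        (ennreal (exp (l\<^sup>2 / 2) * exp ?w) + ennreal (exp (l\<^sup>2 / 2) * exp (- ?w)))"
      unfolding nn_integral_std_gauss_pair_exp by (simp only: power2_minus uv)
    also have "\<dots> = ennreal (exp (l\<^sup>2 / 2)) * ennreal (cosh ?w / (2 * pi))"
      by (simp add: cosh_def field_simps flip: ennreal_mult ennreal_plus)
    finally show ?thesis .
  qed
  \<comment> \<open>The angle is moved outwards past one Gaussian variable at a time.\<close>
  have "(\<integral>\<^sup>+a. \<integral>\<^sup>+b. circle_avg (l * (x + a)) (l * (y + b)) \<partial>std_gauss \<partial>std_gauss) =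
      (\<integral>\<^sup>+a. \<integral>\<^sup>+t. \<integral>\<^sup>+b. indicator {0..2 * pi} t * ?g t a b \<partial>std_gauss \<partial>lborel \<partial>std_gauss)"
    unfolding circle_avg_def by (intro nn_integral_cong Fubini'[symmetric]) measurable
  also have "\<dots> = (\<integral>\<^sup>+t. \<integral>\<^sup>+a. \<integral>\<^sup>+b. indicator {0..2 * pi} t * ?g t a b \<partial>std_gauss \<partial>std_gauss \<partial>lborel)"
    by (rule Fubini'[symmetric]) measurable
  also have "\<dots> = (\<integral>\<^sup>+t. indicator {0..2 * pi} t * (\<integral>\<^sup>+a. \<integral>\<^sup>+b. ?g t a b \<partial>std_gauss \<partial>std_gauss) \<partial>lborel)"
    by (simp add: nn_integral_cmult)
  also have "\<dots> = (\<integral>\<^sup>+t. ennreal (exp (l\<^sup>2 / 2)) *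
      (indicator {0..2 * pi} t * ennreal (cosh (l * x * cos t + l * y * sin t) / (2 * pi))) \<partial>lborel)"
    unfolding inner by (simp add: ac_simps)
  also have "\<dots> = ennreal (exp (l\<^sup>2 / 2)) * circle_avg (l * x) (l * y)"
    unfolding circle_avg_def by (rule nn_integral_cmult) measurable
  finally show ?thesis .
qed

section \<open>First exits of a Gaussian random walk\<close>

text \<open>
  The probability that the walk started at \<open>(x, y)\<close> has norm at least \<open>r\<close> at one of the times \<open>0, \<dots>, n\<close>.
\<close>

fun exit_prob :: "nat \<Rightarrow> real \<Rightarrow> real \<Rightarrow> real \<Rightarrow> ennreal" where
  "exit_prob 0 r x y = (if r \<le> sqrt (x\<^sup>2 + y\<^sup>2) then 1 else 0)"
| "exit_prob (Suc n) r x y = (if r \<le> sqrt (x\<^sup>2 + y\<^sup>2) then 1 else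
     (\<integral>\<^sup>+a. \<integral>\<^sup>+b. exit_prob n r (x + a) (y + b) \<partial>std_gauss \<partial>std_gauss))"

text \<open>Joint measurability, since the recursion integrates over shifts of the starting point
  and the layer cake formula over the radius.\<close>

lemma borel_measurable_exit_prob_triple:
  "(\<lambda>z. exit_prob n (fst z) (fst (snd z)) (snd (snd z))) \<in> borel_measurable (borel \<Otimes>\<^sub>M borel \<Otimes>\<^sub>M borel)"
proof (induction n)
  case 0
  show ?case unfolding exit_prob.simps by measurable
next
  case (Suc n)
  \<comment> \<open>The two step variables \<open>a\<close> and \<open>b\<close> are adjoined to the
    triple, which explains the product type.\<close>
  have [measurable]: "(\<lambda>w. exit_prob n (f w) (g w) (h w)) \<in> borel_measurable M"
    if [measurable]: "f \<in> borel_measurable M" "g \<in> borel_measurable M" "h \<in> borel_measurable M"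
    for f g h and M :: "(((real \<times> real \<times> real) \<times> real) \<times> real) measure"
    using measurable_compose[OF _ Suc, of "\<lambda>w. (f w, g w, h w)" M] by simp
  show ?case unfolding exit_prob.simps by measurable
qed

lemma borel_measurable_exit_prob [measurable (raw)]:
  assumes [measurable]: "f \<in> borel_measurable M" "g \<in> borel_measurable M" "h \<in> borel_measurable M"
  shows "(\<lambda>w. exit_prob n (f w) (g w) (h w)) \<in> borel_measurable M"
  using measurable_compose[OF _ borel_measurable_exit_prob_triple, of "\<lambda>w. (f w, g w, h w)" M] by simp

lemma exit_prob_le_1: "exit_prob n r x y \<le> 1"
proof (induction n arbitrary: x y)
  case (Suc n)
  have "(\<integral>\<^sup>+a. \<integral>\<^sup>+b. exit_prob n r (x + a) (y + b) \<partial>std_gauss \<partial>std_gauss) \<le>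
      (\<integral>\<^sup>+a. \<integral>\<^sup>+b. 1 \<partial>std_gauss \<partial>std_gauss)"
    by (intro nn_integral_mono Suc)
  also have "\<dots> = 1"
    using std_gauss.emeasure_space_1 by simp
  finally show ?case by simp
qed simp

text \<open>Induction on the truncation \<open>N\<close>, for all starting points at once. Outside
  the disc the geometric sum is at most 1 and \<open>I_0\<close> is monotone; inside, one step of
  the walk costs \<open>q\<close>, which cancels the growth factor of the circle average.\<close>

lemma sum_exit_prob_le:
  fixes l r :: real
  assumes l: "0 \<le> l" and r: "0 \<le> r"
  defines "q \<equiv> exp (- (l\<^sup>2 / 2))"
  shows "ennreal (bessel_I 0 (l * r)) * (ennreal (1 - q) * (\<Sum>n<N. ennreal (q ^ n) * exit_prob n r x y))
    \<le> circle_avg (l * x) (l * y)"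
proof (induction N arbitrary: x y)
  case 0
  then show ?case by simp
next
  case (Suc N)
  have q: "0 < q" "q \<le> 1" by (simp_all add: q_def)
  show ?case
  proof (cases "r \<le> sqrt (x\<^sup>2 + y\<^sup>2)")
    case True
    have norm: "sqrt ((l * x)\<^sup>2 + (l * y)\<^sup>2) = l * sqrt (x\<^sup>2 + y\<^sup>2)"
      using l by (simp add: power_mult_distrib real_sqrt_mult flip: distrib_left)
    have "ennreal (1 - q) * (\<Sum>n<Suc N. ennreal (q ^ n) * exit_prob n r x y)
        \<le> ennreal (1 - q) * (\<Sum>n<Suc N. ennreal (q ^ n) * 1)"
      by (intro mult_left_mono sum_mono exit_prob_le_1) auto
    also have "\<dots> = ennreal ((1 - q) * (\<Sum>n<Suc N. q ^ n))"
      using q by (simp add: ennreal_mult sum_nonneg del: sum.lessThan_Suc)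
    also have "(1 - q) * (\<Sum>n<Suc N. q ^ n) = 1 - q ^ Suc N"
      by (rule one_diff_power_eq[symmetric])
    also have "ennreal (1 - q ^ Suc N) \<le> 1"
      using q by (simp add: ennreal_le_1)
    finally have "ennreal (bessel_I 0 (l * r)) * (ennreal (1 - q) * (\<Sum>n<Suc N. ennreal (q ^ n) * exit_prob n r x y))
        \<le> ennreal (bessel_I 0 (l * r)) * 1"
      by (rule mult_left_mono) simp
    also have "\<dots> \<le> ennreal (bessel_I 0 (l * sqrt (x\<^sup>2 + y\<^sup>2)))"
      using True l r by (auto intro!: ennreal_leI bessel_I_0_mono mult_left_mono)
    also have "\<dots> \<le> circle_avg (l * x) (l * y)"
      using bessel_I_0_le_circle_avg[of "l * x" "l * y"] unfolding norm .
    finally show ?thesis .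
  next
    case False
    let ?C = "ennreal (bessel_I 0 (l * r))"
    let ?s = "\<lambda>x y. \<Sum>n<N. ennreal (q ^ n) * exit_prob n r x y"
    \<comment> \<open>The term for time 0 vanishes inside the disc; shifting the index in the others
      releases a factor \<open>q\<close>.\<close>
    have "(\<Sum>n<Suc N. ennreal (q ^ n) * exit_prob n r x y) =
        (\<Sum>n<N. ennreal q * (ennreal (q ^ n) *
          (\<integral>\<^sup>+a. \<integral>\<^sup>+b. exit_prob n r (x + a) (y + b) \<partial>std_gauss \<partial>std_gauss)))"
      using False q by (simp add: sum.lessThan_Suc_shift ennreal_mult mult.assoc del: sum.lessThan_Suc)
    also have "\<dots> = ennreal q * (\<integral>\<^sup>+a. \<integral>\<^sup>+b. ?s (x + a) (y + b) \<partial>std_gauss \<partial>std_gauss)"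
      by (simp add: nn_integral_sum nn_integral_cmult sum_distrib_left)
    finally have "?C * (ennreal (1 - q) * (\<Sum>n<Suc N. ennreal (q ^ n) * exit_prob n r x y)) =
        ennreal q * (\<integral>\<^sup>+a. \<integral>\<^sup>+b. ?C * (ennreal (1 - q) * ?s (x + a) (y + b)) \<partial>std_gauss \<partial>std_gauss)"
      by (simp add: nn_integral_cmult ac_simps del: sum.lessThan_Suc)
    also have "\<dots> \<le> ennreal q *
        (\<integral>\<^sup>+a. \<integral>\<^sup>+b. circle_avg (l * (x + a)) (l * (y + b)) \<partial>std_gauss \<partial>std_gauss)"
      by (intro mult_left_mono nn_integral_mono Suc) simp
    also have "\<dots> = ennreal (q * exp (l\<^sup>2 / 2)) * circle_avg (l * x) (l * y)"
      using q by (simp add: circle_avg_heat ennreal_mult mult.assoc)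
    also have "q * exp (l\<^sup>2 / 2) = 1"
      by (simp add: q_def flip: exp_add)
    finally show ?thesis by simp
  qed
qed

text \<open>The expectation of \<open>max\<^sub>k\<^sub>\<le>\<^sub>n |S\<^sub>k|\<close> for the walk started at the origin, by the layer cake formula.\<close>

definition expected_max :: "nat \<Rightarrow> ennreal" where
  "expected_max n = (\<integral>\<^sup>+r. exit_prob n r 0 0 * indicator {0<..} r \<partial>lborel)"

section \<open>Integration of the exit bound over the radius\<close>

text \<open>Domination by \<open>4 / (1 + r^2)\<close>, an arctangent integrand.\<close>

lemma set_integrable_inverse_bessel_I_0: "set_integrable lborel {0<..} (\<lambda>r. 1 / bessel_I 0 r)"
proof (rule set_integrable_bound)
  show "set_integrable lborel {0<..} (\<lambda>r. 4 * (1 / (1 + r\<^sup>2)) :: real)"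
    using integrable_I0i_1_div_plus_square
    by (intro set_integrable_mult_right)
       (simp add: interval_lebesgue_integrable_def einterval_def greaterThan_def zero_ereal_def)
  show "set_borel_measurable lborel {0<..} (\<lambda>r. 1 / bessel_I 0 r)"
    unfolding set_borel_measurable_def by measurable
  show "AE r in lborel. r \<in> {0<..} \<longrightarrow> norm (1 / bessel_I 0 r) \<le> norm (4 * (1 / (1 + r\<^sup>2)))"
  proof (intro always_eventually allI impI)
    fix r :: real
    have "(1 + r\<^sup>2) / 4 \<le> bessel_I 0 r"
      using bessel_I_0_ge_quadratic[of r] by (simp add: add_divide_distrib)
    then have "1 / bessel_I 0 r \<le> 1 / ((1 + r\<^sup>2) / 4)"
      by (intro divide_left_mono) (auto intro!: mult_pos_pos bessel_I_0_pos simp: add_pos_nonneg)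
    then show "norm (1 / bessel_I 0 r) \<le> norm (4 * (1 / (1 + r\<^sup>2)))"
      using bessel_I_0_pos[of r] by (simp add: add_nonneg_nonneg)
  qed
qed

lemma set_integral_inverse_bessel_I_0_nonneg: "0 \<le> (LBINT r:{0<..}. 1 / bessel_I 0 r)"
  unfolding set_lebesgue_integral_def
  using bessel_I_0_pos[THEN less_imp_le] by (intro integral_nonneg_AE AE_I2) auto

lemma nn_integral_inverse_bessel_I_0:
  "(\<integral>\<^sup>+r. ennreal (1 / bessel_I 0 r) * indicator {0<..} r \<partial>lborel) =
    ennreal (LBINT r:{0<..}. 1 / bessel_I 0 r)"
proof -
  have "(\<integral>\<^sup>+r. ennreal (1 / bessel_I 0 r) * indicator {0<..} r \<partial>lborel) =
      (\<integral>\<^sup>+r. ennreal (indicator {0<..} r *\<^sub>R (1 / bessel_I 0 r)) \<partial>lborel)"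
    by (intro nn_integral_cong) (simp split: split_indicator)
  also have "\<dots> = ennreal (LBINT r:{0<..}. 1 / bessel_I 0 r)"
    unfolding set_lebesgue_integral_def
    using set_integrable_inverse_bessel_I_0 bessel_I_0_pos[THEN less_imp_le]
    by (intro nn_integral_eq_integral) (auto simp: set_integrable_def)
  finally show ?thesis .
qed

text \<open>The exit bound is used at the origin, where the circle average is 1, and integrated over
  \<open>r\<close>; taking \<open>l * r\<close> as the new variable produces the factor
  \<open>1 / l\<close>.\<close>

lemma sum_expected_max_le:
  fixes l :: real
  assumes l: "0 < l"
  defines "q \<equiv> exp (- (l\<^sup>2 / 2))"
  shows "ennreal (1 - q) * (\<Sum>n<N. ennreal (q ^ n) * expected_max n) \<le>
    ennreal ((LBINT r:{0<..}. 1 / bessel_I 0 r) / l)"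
proof -
  have q: "0 < q" "q \<le> 1" by (simp_all add: q_def)
  have "ennreal (1 - q) * (\<Sum>n<N. ennreal (q ^ n) * expected_max n) =
      (\<integral>\<^sup>+r. (ennreal (1 - q) * (\<Sum>n<N. ennreal (q ^ n) * exit_prob n r 0 0)) * indicator {0<..} r \<partial>lborel)"
    unfolding expected_max_def
    by (simp add: nn_integral_sum nn_integral_cmult sum_distrib_right mult.assoc)
  also have "\<dots> \<le> (\<integral>\<^sup>+r. ennreal (1 / bessel_I 0 (l * r)) * indicator {0<..} (l * r) \<partial>lborel)"
  proof (rule nn_integral_mono)
    fix r :: real
    show "(ennreal (1 - q) * (\<Sum>n<N. ennreal (q ^ n) * exit_prob n r 0 0)) * indicator {0<..} r
        \<le> ennreal (1 / bessel_I 0 (l * r)) * indicator {0<..} (l * r)"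
    proof (cases "0 < r")
      case True
      let ?S = "ennreal (1 - q) * (\<Sum>n<N. ennreal (q ^ n) * exit_prob n r 0 0)"
      have "ennreal (bessel_I 0 (l * r)) * ?S \<le> 1"
        using sum_exit_prob_le[OF less_imp_le[OF l] less_imp_le[OF True], where N = N and x = 0 and y = 0]
        unfolding q_def by (simp only: mult_zero_right circle_avg_0)
      then have "ennreal (1 / bessel_I 0 (l * r)) * (ennreal (bessel_I 0 (l * r)) * ?S)
          \<le> ennreal (1 / bessel_I 0 (l * r)) * 1"
        by (rule mult_left_mono) simp
      moreover have "ennreal (1 / bessel_I 0 (l * r)) * (ennreal (bessel_I 0 (l * r)) * ?S) = ?S"
        using bessel_I_0_pos[of "l * r"] by (simp flip: mult.assoc ennreal_mult)
      ultimately show ?thesis using True l by simp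
    qed simp
  qed
  \<comment> \<open>The form \<open>0 + l * r\<close> matches the affine change of variables applied
    next.\<close>
  also have "\<dots> = ennreal (1 / l) * (ennreal l *
      (\<integral>\<^sup>+r. ennreal (1 / bessel_I 0 (0 + l * r)) * indicator {0<..} (0 + l * r) \<partial>lborel))"
    using l by (simp flip: mult.assoc ennreal_mult)
  also have "ennreal l * (\<integral>\<^sup>+r. ennreal (1 / bessel_I 0 (0 + l * r)) * indicator {0<..} (0 + l * r) \<partial>lborel) =
      (\<integral>\<^sup>+r. ennreal (1 / bessel_I 0 r) * indicator {0<..} r \<partial>lborel)"
    using l by (subst (2) nn_integral_real_affine[where c = l and t = 0]) auto
  also have "ennreal (1 / l) * \<dots> = ennreal ((LBINT r:{0<..}. 1 / bessel_I 0 r) / l)"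
    unfolding nn_integral_inverse_bessel_I_0 using l
    by (simp add: divide_inverse mult.commute flip: ennreal_mult')
  finally show ?thesis .
qed

section \<open>The growth constant of the expected maximum\<close>

text \<open>With t = r^2 / 2 one has sqrt (2 t) = r, and t^(-1/2) dt becomes sqrt 2 dr.\<close>

lemma set_integral_bessel_substitution:
  "(LBINT t:{0<..}. t powr (- 1 / 2) / bessel_I 0 (sqrt (2 * t))) =
    sqrt 2 * (LBINT r:{0<..}. 1 / bessel_I 0 r)"
proof -
  let ?f = "\<lambda>t. t powr (- 1 / 2) / bessel_I 0 (sqrt (2 * t))"
  have Ioi: "einterval 0 \<infinity> = {0<..}"
    by (simp add: einterval_def greaterThan_def zero_ereal_def)
  have eq: "?f (r\<^sup>2 / 2) * r = sqrt 2 * (1 / bessel_I 0 r)" if "0 < r" for r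
  proof -
    have "(r\<^sup>2 / 2) powr (- 1 / 2) = sqrt 2 / r"
      using that by (simp add: powr_minus powr_half_sqrt real_sqrt_divide inverse_eq_divide)
    then show ?thesis using that by simp
  qed
  have "(LBINT t=0..\<infinity>. ?f t) = (LBINT r=0..\<infinity>. ?f (r\<^sup>2 / 2) * r)"
  proof (rule interval_integral_substitution_nonneg)
    show "set_integrable lborel (einterval 0 \<infinity>) (\<lambda>r. ?f (r\<^sup>2 / 2) * r)"
      using set_integrable_mult_right[OF set_integrable_inverse_bessel_I_0, of "sqrt 2"]
      unfolding Ioi by (rule set_integrable_cong[THEN iffD1, rotated 3]) (simp_all only: eq greaterThan_iff)
    show "((ereal \<circ> (\<lambda>r. r\<^sup>2 / 2) \<circ> real_of_ereal) \<longlongrightarrow> 0) (at_right 0)"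
      unfolding zero_ereal_def ereal_tendsto_simps by real_asymp
    show "((ereal \<circ> (\<lambda>r. r\<^sup>2 / 2) \<circ> real_of_ereal) \<longlongrightarrow> \<infinity>) (at_left \<infinity>)"
      unfolding ereal_tendsto_simps by real_asymp
  next
    fix r :: real
    assume "0 < ereal r"
    then have r: "0 < r" by simp
    show "((\<lambda>r. r\<^sup>2 / 2) has_real_derivative r) (at r)"
      by (auto intro!: derivative_eq_intros)
    have "r\<^sup>2 / 2 \<noteq> 0" using r by simp
    moreover have "isCont (\<lambda>t. bessel_I 0 (sqrt (2 * t))) (r\<^sup>2 / 2)"
      by (rule isCont_o2[OF _ isCont_bessel_I_0]) (intro continuous_intros)
    ultimately show "isCont ?f (r\<^sup>2 / 2)"
      using bessel_I_0_pos[of "sqrt (2 * (r\<^sup>2 / 2))"] by (intro continuous_intros) simp_all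
    show "0 \<le> ?f (r\<^sup>2 / 2)"
      by (intro divide_nonneg_nonneg powr_ge_zero less_imp_le[OF bessel_I_0_pos])
  qed simp_all
  then have "(LBINT t:{0<..}. ?f t) = (LBINT r:{0<..}. ?f (r\<^sup>2 / 2) * r)"
    by (simp add: interval_lebesgue_integral_def Ioi)
  also have "\<dots> = (LBINT r:{0<..}. sqrt 2 * (1 / bessel_I 0 r))"
    
  proof (intro set_lebesgue_integral_cong allI impI)
    show "?f (r\<^sup>2 / 2) * r = sqrt 2 * (1 / bessel_I 0 r)" if "r \<in> {0<..}" for r
      using that by (intro eq) simp
  qed simp
  finally show ?thesis by (simp only: set_integral_mult_right)
qed

section \<open>Comparison of weighted sums with the Gamma integral\<close>

text \<open>Rescale the Gamma integral by \<open>a\<close> and bound the integrand on each unit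
  cell, with the square root at the right end and the exponential at the left end. Aligning the two
  ends costs the factor \<open>exp a\<close>, harmless as \<open>a\<close> tends to 0.\<close>

lemma Gamma_le_of_sum_sqrt_le:
  fixes a :: real
  assumes a: "0 < a" and B: "\<And>N. (\<Sum>n<N. exp (- (a * real n)) * sqrt (real n)) \<le> B"
  shows "Gamma (3 / 2) \<le> a * sqrt a * exp a * B"
proof -
  let ?g = "\<lambda>n. exp (- (a * real n)) * sqrt (real (Suc n))"
  have "ennreal (Gamma (3 / 2)) = (\<integral>\<^sup>+t. ennreal (indicator {0..} t * (t powr (1 / 2) / exp t)) \<partial>lborel)"
    using nn_integral_has_integral_lebesgue[OF _ Gamma_integral_real[of "3 / 2"]] by simp
  also have "\<dots> = ennreal a * (\<integral>\<^sup>+x. ennreal (indicator {0..} (0 + a * x) * ((0 + a * x) powr (1 / 2) / exp (0 + a * x))) \<partial>lborel)"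
    using a by (subst nn_integral_real_affine[where c = a and t = 0]) auto
  also have "\<dots> \<le> ennreal a * (\<integral>\<^sup>+x. (\<Sum>n. ennreal (sqrt a * ?g n) * indicator {real n..<real (Suc n)} x) \<partial>lborel)"
  proof (intro mult_left_mono nn_integral_mono)
    fix x :: real
    show "ennreal (indicator {0..} (0 + a * x) * ((0 + a * x) powr (1 / 2) / exp (0 + a * x))) \<le>
        (\<Sum>n. ennreal (sqrt a * ?g n) * indicator {real n..<real (Suc n)} x)"
    proof (cases "0 \<le> x")
      case True
      define n where "n = nat \<lfloor>x\<rfloor>"
      have n: "real n \<le> x" "x < real (Suc n)" using True by (auto simp: n_def) linarith+
      have "sqrt x * exp (- (a * x)) \<le> sqrt (real (Suc n)) * exp (- (a * real n))"
        using n a by (intro mult_mono) auto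
      then have "(a * x) powr (1 / 2) / exp (a * x) \<le> sqrt a * ?g n"
        using True a by (simp add: powr_half_sqrt real_sqrt_mult exp_minus field_simps)
      then have "ennreal (indicator {0..} (0 + a * x) * ((0 + a * x) powr (1 / 2) / exp (0 + a * x))) \<le>
          ennreal (sqrt a * ?g n) * indicator {real n..<real (Suc n)} x"
        using True a n by (simp add: ennreal_leI)
      also have "\<dots> = (\<Sum>n\<in>{n}. ennreal (sqrt a * ?g n) * indicator {real n..<real (Suc n)} x)"
        by (subst sum.insert) simp_all
      also have "\<dots> \<le> (\<Sum>n. ennreal (sqrt a * ?g n) * indicator {real n..<real (Suc n)} x)"
        by (rule sum_le_suminf) auto
      finally show ?thesis .
    next
      case False
      then have "a * x < 0" using a by (simp add: mult_less_0_iff)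
      then show ?thesis by simp
    qed
  qed simp
  also have "\<dots> = ennreal a * (\<Sum>n. ennreal (sqrt a * ?g n))"
    by (simp add: nn_integral_suminf nn_integral_cmult_indicator)
  also have "\<dots> \<le> ennreal a * ennreal (sqrt a * (exp a * B))"
  proof (intro mult_left_mono suminf_le_const summableI)
    fix N
    have "(\<Sum>n<N. ?g n) = exp a * (\<Sum>n<N. exp (- (a * real (Suc n))) * sqrt (real (Suc n)))"
    proof -
      have "exp (- (a * real n)) = exp a * exp (- (a * real (Suc n)))" for n
        by (simp add: distrib_left flip: exp_add)
      then have "?g n = exp a * (exp (- (a * real (Suc n))) * sqrt (real (Suc n)))" for n
        by (metis mult.assoc)
      then show ?thesis unfolding sum_distrib_left by (intro sum.cong refl)
    qed
    \<comment> \<open>The added term for index 0 is zero because sqrt 0 = 0.\<close>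
    also have "\<dots> = exp a * (\<Sum>n<Suc N. exp (- (a * real n)) * sqrt (real n))"
      by (simp add: sum.lessThan_Suc_shift del: sum.lessThan_Suc)
    also have "\<dots> \<le> exp a * B" by (intro mult_left_mono B) simp
    finally have "sqrt a * (\<Sum>n<N. ?g n) \<le> sqrt a * (exp a * B)"
      using a by (intro mult_left_mono) auto
    moreover have "(\<Sum>n<N. ennreal (sqrt a * ?g n)) = ennreal (sqrt a * (\<Sum>n<N. ?g n))"
      using a by (subst sum_ennreal) (auto simp: sum_distrib_left)
    ultimately show "(\<Sum>n<N. ennreal (sqrt a * ?g n)) \<le> ennreal (sqrt a * (exp a * B))"
      by (simp add: ennreal_leI)
  qed simp
  also have "\<dots> = ennreal (a * sqrt a * exp a * B)"
    using a B[of 0] by (simp add: mult.assoc flip: ennreal_mult)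
  finally show ?thesis
    using a B[of 0] by (subst (asm) ennreal_le_iff) auto
qed

text \<open>An Abelian argument: insert the growth into the generating function with weight
  \<open>exp (- a)\<close>, compare with the Gamma integral and let \<open>a\<close> tend to
  0.\<close>

lemma sqrt_growth_constant_le:
  fixes d :: "nat \<Rightarrow> real"
  assumes d: "\<And>n. 0 \<le> d n"
    and bound: "\<And>a N. 0 < a \<Longrightarrow>
      (1 - exp (- a)) * (\<Sum>n<N. exp (- a) ^ n * d n) \<le> K / sqrt (2 * a)"
    and c: "0 < c" and growth: "\<And>n. m \<le> n \<Longrightarrow> c * sqrt (real n) \<le> d n"
  shows "c * Gamma (1 / 2) \<le> sqrt 2 * K"
proof -
  \<comment> \<open>\<open>C\<close> absorbs the indices below \<open>m\<close>; its contribution is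
    of order \<open>sqrt a\<close> and disappears in the limit.\<close>
  define C where "C = c * sqrt (real m)"
  have C: "0 \<le> C" using c by (simp add: C_def)
  have le: "c * sqrt (real n) \<le> d n + C" for n
  proof (cases "m \<le> n")
    case False
    then have "c * sqrt (real n) \<le> C" unfolding C_def using c by simp
    then show ?thesis using d[of n] by linarith
  qed (use growth[of n] C in linarith)
  have main: "c * Gamma (3 / 2) * ((1 - exp (- a)) / a) \<le> exp a * (K / sqrt 2 + C * sqrt a)"
    if a: "0 < a" for a :: real
  proof -
    let ?q = "exp (- a)"
    have q: "0 < ?q" "?q < 1" using a by auto
    have "(\<Sum>n<N. exp (- (a * real n)) * sqrt (real n)) \<le> (K / sqrt (2 * a) + C) / (c * (1 - ?q))" for N
    proof -
      have "c * (\<Sum>n<N. exp (- (a * real n)) * sqrt (real n)) = (\<Sum>n<N. ?q ^ n * (c * sqrt (real n)))"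
        by (simp add: sum_distrib_left mult_ac flip: exp_of_nat_mult)
      also have "\<dots> \<le> (\<Sum>n<N. ?q ^ n * (d n + C))"
        by (intro sum_mono mult_left_mono le) auto
      also have "\<dots> = (\<Sum>n<N. ?q ^ n * d n) + C * (\<Sum>n<N. ?q ^ n)"
        by (simp add: algebra_simps sum.distrib sum_distrib_left)
      finally have "(1 - ?q) * (c * (\<Sum>n<N. exp (- (a * real n)) * sqrt (real n))) \<le>
          (1 - ?q) * ((\<Sum>n<N. ?q ^ n * d n) + C * (\<Sum>n<N. ?q ^ n))"
        using q by (intro mult_left_mono) auto
      \<comment> \<open>The factor \<open>1 - ?q\<close> sums the geometric series attached to
        \<open>C\<close>.\<close>
      also have "\<dots> = (1 - ?q) * (\<Sum>n<N. ?q ^ n * d n) + C * (1 - ?q ^ N)"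
        by (simp only: one_diff_power_eq) (simp add: algebra_simps)
      also have "\<dots> \<le> K / sqrt (2 * a) + C * 1"
        using q C by (intro add_mono bound a mult_left_mono) auto
      finally show ?thesis
        using q c by (simp add: pos_le_divide_eq mult_ac)
    qed
    from Gamma_le_of_sum_sqrt_le[OF a this]
    have "Gamma (3 / 2) \<le> a * sqrt a * exp a * ((K / sqrt (2 * a) + C) / (c * (1 - ?q)))" .
    then have "Gamma (3 / 2) * (c * (1 - ?q)) \<le> a * sqrt a * exp a * (K / sqrt (2 * a) + C)"
      using q c by (simp add: pos_le_divide_eq)
    also have "\<dots> = a * (exp a * (K / sqrt 2 + C * sqrt a))"
      using a by (simp add: real_sqrt_mult field_simps)
    finally show ?thesis using a by (simp add: field_simps)
  qed
  have "c * Gamma (3 / 2) * 1 \<le> exp 0 * (K / sqrt 2 + C * sqrt 0)"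
  proof (rule tendsto_le)
    show "((\<lambda>a::real. c * Gamma (3 / 2) * ((1 - exp (- a)) / a)) \<longlongrightarrow> c * Gamma (3 / 2) * 1) (at_right 0)"
      by (intro tendsto_mult_left) real_asymp
    show "((\<lambda>a::real. exp a * (K / sqrt 2 + C * sqrt a)) \<longlongrightarrow> exp 0 * (K / sqrt 2 + C * sqrt 0)) (at_right 0)"
      by (intro tendsto_intros)
    show "\<forall>\<^sub>F a in at_right 0. c * Gamma (3 / 2) * ((1 - exp (- a)) / a) \<le> exp a * (K / sqrt 2 + C * sqrt a)"
      using eventually_at_right_less[of 0] by eventually_elim (rule main)
  qed simp
  moreover have "Gamma (3 / 2 :: real) = Gamma (1 / 2) / 2"
    \<comment> \<open>The functional equation at 1/2, which is not a pole of Gamma.\<close>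
    using Gamma_plus1[of "1 / 2 :: real"] nonpos_Ints_nonpos[of "1 / 2 :: real"] by auto
  ultimately have "c * Gamma (1 / 2) \<le> 2 / sqrt 2 * K" by (simp add: field_simps)
  then show ?thesis by (simp only: real_div_sqrt)
qed

section \<open>Brownian motion on a grid\<close>

interpretation std_gauss_product: product_prob_space "\<lambda>_ :: nat. std_gauss" "UNIV"
  by standard

text \<open>The first index \<open>k\<close> is a parameter, so that removing the first step leaves
  the other increments at their indices.\<close>

abbreviation walk_exceeds ::
    "nat \<Rightarrow> nat \<Rightarrow> real \<Rightarrow> real \<Rightarrow> real \<Rightarrow> (nat \<Rightarrow> real) \<Rightarrow> (nat \<Rightarrow> real) \<Rightarrow> bool" where
  "walk_exceeds k n r x y u v \<equiv>
    \<exists>j\<in>{k..n}. r \<le> sqrt ((x + (\<Sum>i\<in>{k..<j}. u i))\<^sup>2 + (y + (\<Sum>i\<in>{k..<j}. v i))\<^sup>2)"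

lemma measurable_walk_exceeds:
  assumes f: "f \<in> M \<rightarrow>\<^sub>M PiM {k..<n} (\<lambda>_. std_gauss)" and g: "g \<in> M \<rightarrow>\<^sub>M PiM {k..<n} (\<lambda>_. std_gauss)"
    and [measurable]: "x \<in> borel_measurable M" "y \<in> borel_measurable M" "r \<in> borel_measurable M"
  shows "Measurable.pred M (\<lambda>w. walk_exceeds k n (r w) (x w) (y w) (f w) (g w))"
proof (rule pred_intros_finite(4))
  fix j assume j: "j \<in> {k..n}"
  have component: "(\<lambda>w. h w i) \<in> borel_measurable M"
    if "h \<in> M \<rightarrow>\<^sub>M PiM {k..<n} (\<lambda>_. std_gauss)" "i \<in> {k..<j}" for h i
  proof -
    have "i \<in> {k..<n}" using that(2) j by simp
    from measurable_compose[OF that(1) measurable_component_singleton[OF this]]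
    show ?thesis by simp
  qed
  have [measurable]: "(\<lambda>w. \<Sum>i\<in>{k..<j}. f w i) \<in> borel_measurable M"
    "(\<lambda>w. \<Sum>i\<in>{k..<j}. g w i) \<in> borel_measurable M"
    by (intro borel_measurable_sum component f g; assumption)+
  show "Measurable.pred M (\<lambda>w. r w \<le> sqrt ((x w + (\<Sum>i\<in>{k..<j}. f w i))\<^sup>2 + (y w + (\<Sum>i\<in>{k..<j}. g w i))\<^sup>2))"
    by measurable
qed simp

lemma borel_measurable_of_bool [measurable (raw)]:
  "Measurable.pred M P \<Longrightarrow> (\<lambda>w. of_bool (P w) :: ennreal) \<in> borel_measurable M"
  unfolding of_bool_def by measurable

text \<open>Peeling the coordinate \<open>k\<close> off both product measures reproduces the
  recursion of \<open>exit_prob\<close>.\<close>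

lemma exit_prob_eq_PiM:
  "(\<integral>\<^sup>+u. \<integral>\<^sup>+v. of_bool (walk_exceeds k (k + m) r x y u v)
      \<partial>PiM {k..<k + m} (\<lambda>_. std_gauss) \<partial>PiM {k..<k + m} (\<lambda>_. std_gauss)) = exit_prob m r x y"
proof (induction m arbitrary: k x y)
  case 0
  interpret P: prob_space "PiM {k..<k} (\<lambda>_. std_gauss)" by (intro prob_space_PiM) unfold_locales
  show ?case using P.emeasure_space_1 by simp
next
  case (Suc m)
  let ?J = "{Suc k..<Suc k + m}"
  let ?P = "PiM ?J (\<lambda>_. std_gauss)" and ?Q = "PiM {k..<k + Suc m} (\<lambda>_. std_gauss)"
  interpret P: prob_space ?P by (intro prob_space_PiM) unfold_locales
  interpret Q: prob_space ?Q by (intro prob_space_PiM) unfold_locales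
  interpret PG: pair_sigma_finite std_gauss ?P ..
  show ?case
  proof (cases "r \<le> sqrt (x\<^sup>2 + y\<^sup>2)")
    case True
    then have "walk_exceeds k (k + Suc m) r x y u v" for u v
      by (intro bexI[of _ k]) auto
    then show ?thesis using True Q.emeasure_space_1 by simp
  next
    case False
    have ins: "{k..<k + Suc m} = insert k ?J" by auto
    \<comment> \<open>As the start lies inside the disc, time \<open>k\<close> does not count, and
      the first step only moves the starting point.\<close>
    have step: "walk_exceeds k (k + Suc m) r x y (u(k := a)) (v(k := b)) \<longleftrightarrow>
        walk_exceeds (Suc k) (Suc k + m) r (x + a) (y + b) u v" for u v a b
    proof -
      have sum_eq: "(\<Sum>i\<in>{k..<j}. (w(k := c)) i) = c + (\<Sum>i\<in>{Suc k..<j}. w i)"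
        if "j \<in> {Suc k..Suc k + m}" for j and c :: real and w
        using that by (subst sum.atLeast_Suc_lessThan) auto
      have "{k..k + Suc m} = insert k {Suc k..Suc k + m}" by auto
      then have "walk_exceeds k (k + Suc m) r x y (u(k := a)) (v(k := b)) \<longleftrightarrow>
          (\<exists>j\<in>{Suc k..Suc k + m}. r \<le> sqrt ((x + (\<Sum>i\<in>{k..<j}. (u(k := a)) i))\<^sup>2 + (y + (\<Sum>i\<in>{k..<j}. (v(k := b)) i))\<^sup>2))"
        using False by simp
      also have "\<dots> \<longleftrightarrow> walk_exceeds (Suc k) (Suc k + m) r (x + a) (y + b) u v"
        by (intro bex_cong refl) (simp only: sum_eq add.assoc)
      finally show ?thesis .
    qed
    let ?F = "\<lambda>u v. of_bool (walk_exceeds k (k + Suc m) r x y u v) :: ennreal"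
    let ?F' = "\<lambda>a b u v. of_bool (walk_exceeds (Suc k) (Suc k + m) r (x + a) (y + b) u v) :: ennreal"
    have Fm: "(\<lambda>w. ?F (f w) (g w)) \<in> borel_measurable N"
      if "f \<in> N \<rightarrow>\<^sub>M ?Q" "g \<in> N \<rightarrow>\<^sub>M ?Q" for N and f g :: "'c \<Rightarrow> nat \<Rightarrow> real"
      by (intro borel_measurable_of_bool measurable_walk_exceeds that measurable_const) simp_all
    have F'm: "(\<lambda>w. ?F' a (b w) (f w) (g w)) \<in> borel_measurable N"
      if [measurable]: "f \<in> N \<rightarrow>\<^sub>M ?P" "g \<in> N \<rightarrow>\<^sub>M ?P" "b \<in> borel_measurable N"
      for N a b and f g :: "'c \<Rightarrow> nat \<Rightarrow> real"
      by (rule borel_measurable_of_bool, rule measurable_walk_exceeds[OF that(1,2)]) measurable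
    have "(\<lambda>u. \<integral>\<^sup>+v. ?F u v \<partial>?Q) \<in> borel_measurable ?Q"
      by (rule Q.borel_measurable_nn_integral, simp only: split_beta', rule Fm[OF measurable_fst measurable_snd])
    then have "(\<integral>\<^sup>+u. \<integral>\<^sup>+v. ?F u v \<partial>?Q \<partial>?Q) =
        (\<integral>\<^sup>+a. \<integral>\<^sup>+u. \<integral>\<^sup>+v. ?F (u(k := a)) v \<partial>?Q \<partial>?P \<partial>std_gauss)"
      unfolding ins by (rule std_gauss_product.product_nn_integral_insert_rev[rotated 2]) simp_all
    also have "\<dots> = (\<integral>\<^sup>+a. \<integral>\<^sup>+u. \<integral>\<^sup>+b. \<integral>\<^sup>+v. ?F (u(k := a)) (v(k := b)) \<partial>?P \<partial>std_gauss \<partial>?P \<partial>std_gauss)"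
    proof (intro nn_integral_cong)
      fix a u assume "a \<in> space std_gauss" "u \<in> space ?P"
      then have "u(k := a) \<in> space ?Q"
        unfolding ins by (auto simp: space_PiM PiE_def extensional_def)
      then have "(\<lambda>v. ?F (u(k := a)) v) \<in> borel_measurable ?Q"
        by (intro Fm measurable_const measurable_ident_sets refl)
      then show "(\<integral>\<^sup>+v. ?F (u(k := a)) v \<partial>?Q) = (\<integral>\<^sup>+b. \<integral>\<^sup>+v. ?F (u(k := a)) (v(k := b)) \<partial>?P \<partial>std_gauss)"
        unfolding ins by (rule std_gauss_product.product_nn_integral_insert_rev[rotated 2]) simp_all
    qed
    also have "\<dots> = (\<integral>\<^sup>+a. \<integral>\<^sup>+u. \<integral>\<^sup>+b. \<integral>\<^sup>+v. ?F' a b u v \<partial>?P \<partial>std_gauss \<partial>?P \<partial>std_gauss)"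
      by (simp only: step)
    \<comment> \<open>Exchanging \<open>u\<close> and \<open>b\<close> brings both first steps
      outside, ready for the induction hypothesis.\<close>
    also have "\<dots> = (\<integral>\<^sup>+a. \<integral>\<^sup>+b. \<integral>\<^sup>+u. \<integral>\<^sup>+v. ?F' a b u v \<partial>?P \<partial>?P \<partial>std_gauss \<partial>std_gauss)"
    proof (rule nn_integral_cong, rule PG.Fubini')
      fix a
      have "(\<lambda>z. \<integral>\<^sup>+v. ?F' a (fst z) (snd z) v \<partial>?P) \<in> borel_measurable (std_gauss \<Otimes>\<^sub>M ?P)"
        by (rule P.borel_measurable_nn_integral, simp only: split_beta',
            rule F'm[OF measurable_compose[OF measurable_fst measurable_snd] measurable_snd]) measurable
      then show "(\<lambda>(b, u). \<integral>\<^sup>+v. ?F' a b u v \<partial>?P) \<in> borel_measurable (std_gauss \<Otimes>\<^sub>M ?P)"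
        by (simp only: split_beta')
    qed
    also have "\<dots> = (\<integral>\<^sup>+a. \<integral>\<^sup>+b. exit_prob m r (x + a) (y + b) \<partial>std_gauss \<partial>std_gauss)"
      by (simp only: Suc.IH)
    finally show ?thesis using False by (simp only: exit_prob.simps if_False)
  qed
qed

text \<open>Grid increments have variance 1/n, so the factor \<open>sqrt n\<close> makes them
  standard; independence turns the joint law into the product.\<close>

lemma (in standard_brownian_motion) distr_scaled_increments:
  assumes n: "0 < n"
  shows "distr M (PiM {..<n} (\<lambda>_. borel))
      (\<lambda>\<omega>. \<lambda>i\<in>{..<n}. sqrt (real n) * (B (real (Suc i) / real n) \<omega> - B (real i / real n) \<omega>)) =
    PiM {..<n} (\<lambda>_. std_gauss)"
proof -
  let ?X = "\<lambda>i \<omega>. sqrt (real n) * (B (real (Suc i) / real n) \<omega> - B (real i / real n) \<omega>)"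
  have indep: "indep_vars (\<lambda>_. borel) ?X {..<n}"
    using n
    by (intro indep_vars_compose2[where Y = "\<lambda>_. (*) (sqrt (real n))" and M' = "\<lambda>_. borel"]
        indep_increments[of "\<lambda>i. real i / real n"]) (auto simp: divide_strict_right_mono)
  have rv: "random_variable borel (?X i)" for i
    using random_variable[of "real (Suc i) / real n"] random_variable[of "real i / real n"] by simp
  have law: "distr M borel (?X i) = std_gauss" for i
  proof -
    have lt: "real i / real n < real (Suc i) / real n"
      using n by (intro divide_strict_right_mono) auto
    have "distributed M lborel (\<lambda>\<omega>. B (real (Suc i) / real n) \<omega> - B (real i / real n) \<omega>)
        (normal_density 0 (sqrt (real (Suc i) / real n - real i / real n)))"
      using lt by (intro gaussian_increments) auto
    then have "distributed M lborel (\<lambda>\<omega>. 0 + sqrt (real n) * (B (real (Suc i) / real n) \<omega> - B (real i / real n) \<omega>))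
        (normal_density (0 + sqrt (real n) * 0) (\<bar>sqrt (real n)\<bar> * sqrt (real (Suc i) / real n - real i / real n)))"
      using lt n by (intro normal_density_affine) auto
    moreover have "\<bar>sqrt (real n)\<bar> * sqrt (real (Suc i) / real n - real i / real n) = 1"
      using n by (simp add: diff_divide_distrib[symmetric] real_sqrt_divide)
    ultimately have "distributed M lborel (?X i) (normal_density 0 1)"
      by simp
    from distributed_distr_eq_density[OF this] show ?thesis
      by (simp cong: distr_cong)
  qed
  have "{..<n} \<noteq> {}" using n by auto
  from indep_vars_iff_distr_eq_PiM'[where X = ?X and M' = "\<lambda>_. borel", OF this rv, THEN iffD1, OF indep]
  show ?thesis by (simp only: law)
qed

context planar_brownian_motion
begin

abbreviation increment :: "2 \<Rightarrow> nat \<Rightarrow> nat \<Rightarrow> 'a \<Rightarrow> real" where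
  "increment c n i \<omega> \<equiv> sqrt (real n) * (W (real (Suc i) / real n) \<omega> $ c - W (real i / real n) \<omega> $ c)"

text \<open>Scaled increments as a function of the whole path: through it, independence of the
  coordinate processes passes to the increment vectors.\<close>

lemma measurable_increments:
  "0 < n \<Longrightarrow> (\<lambda>g. \<lambda>i\<in>{..<n}. sqrt (real n) * (g (real (Suc i) / real n) - g (real i / real n)))
    \<in> PiM {0..} (\<lambda>_. borel) \<rightarrow>\<^sub>M PiM {..<n} (\<lambda>_. borel)"
  by (intro measurable_restrict borel_measurable_times borel_measurable_diff measurable_component_singleton) auto

lemma distr_increment_pair:
  assumes n: "0 < n"
  shows "distr M (PiM {..<n} (\<lambda>_. borel) \<Otimes>\<^sub>M PiM {..<n} (\<lambda>_. borel))
      (\<lambda>\<omega>. (\<lambda>i\<in>{..<n}. increment 1 n i \<omega>, \<lambda>i\<in>{..<n}. increment 2 n i \<omega>)) =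
    PiM {..<n} (\<lambda>_. std_gauss) \<Otimes>\<^sub>M PiM {..<n} (\<lambda>_. std_gauss)"
    and random_variable_increments:
      "X.random_variable (PiM {..<n} (\<lambda>_. borel)) (\<lambda>\<omega>. \<lambda>i\<in>{..<n}. increment 1 n i \<omega>)"
      "X.random_variable (PiM {..<n} (\<lambda>_. borel)) (\<lambda>\<omega>. \<lambda>i\<in>{..<n}. increment 2 n i \<omega>)"
proof -
  let ?f = "\<lambda>g :: real \<Rightarrow> real. \<lambda>i\<in>{..<n}. sqrt (real n) * (g (real (Suc i) / real n) - g (real i / real n))"
  have eq: "?f \<circ> (\<lambda>\<omega>. \<lambda>t\<in>{0..}. W t \<omega> $ c) = (\<lambda>\<omega>. \<lambda>i\<in>{..<n}. increment c n i \<omega>)" for c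
    by (auto simp: fun_eq_iff)
  have "X.indep_var (PiM {..<n} (\<lambda>_. borel)) (?f \<circ> (\<lambda>\<omega>. \<lambda>t\<in>{0..}. W t \<omega> $ 1))
      (PiM {..<n} (\<lambda>_. borel)) (?f \<circ> (\<lambda>\<omega>. \<lambda>t\<in>{0..}. W t \<omega> $ 2))"
    by (rule X.indep_var_compose[OF indep_coordinates measurable_increments[OF n] measurable_increments[OF n]])
  then have *: "X.indep_var (PiM {..<n} (\<lambda>_. borel)) (\<lambda>\<omega>. \<lambda>i\<in>{..<n}. increment 1 n i \<omega>)
      (PiM {..<n} (\<lambda>_. borel)) (\<lambda>\<omega>. \<lambda>i\<in>{..<n}. increment 2 n i \<omega>)"
    unfolding eq .
  show "X.random_variable (PiM {..<n} (\<lambda>_. borel)) (\<lambda>\<omega>. \<lambda>i\<in>{..<n}. increment 1 n i \<omega>)"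
    by (rule X.indep_var_rv1[OF *])
  show "X.random_variable (PiM {..<n} (\<lambda>_. borel)) (\<lambda>\<omega>. \<lambda>i\<in>{..<n}. increment 2 n i \<omega>)"
    by (rule X.indep_var_rv2[OF *])
  show "distr M (PiM {..<n} (\<lambda>_. borel) \<Otimes>\<^sub>M PiM {..<n} (\<lambda>_. borel))
      (\<lambda>\<omega>. (\<lambda>i\<in>{..<n}. increment 1 n i \<omega>, \<lambda>i\<in>{..<n}. increment 2 n i \<omega>)) =
    PiM {..<n} (\<lambda>_. std_gauss) \<Otimes>\<^sub>M PiM {..<n} (\<lambda>_. std_gauss)"
    using * unfolding X.indep_var_distribution_eq
    by (simp only: X.distr_scaled_increments[OF n] Y.distr_scaled_increments[OF n])
qed

lemma borel_measurable_W [measurable]: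
  "0 \<le> t \<Longrightarrow> (\<lambda>\<omega>. W t \<omega> $ 1) \<in> borel_measurable M" "0 \<le> t \<Longrightarrow> (\<lambda>\<omega>. W t \<omega> $ 2) \<in> borel_measurable M"
  by (rule X.random_variable Y.random_variable, assumption)+

lemma norm_W: "norm (W t \<omega>) = sqrt ((W t \<omega> $ 1)\<^sup>2 + (W t \<omega> $ 2)\<^sup>2)"
  by (simp add: norm_vec_def L2_set_def UNIV_2)

lemma borel_measurable_norm_W [measurable]: "0 \<le> t \<Longrightarrow> (\<lambda>\<omega>. norm (W t \<omega>)) \<in> borel_measurable M"
  unfolding norm_W by measurable

text \<open>The scaled increments telescope to \<open>sqrt n\<close> times the position, hence the
  scaled threshold.\<close>

lemma prob_grid_exceeds:
  assumes n: "0 < n"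
  shows "(\<integral>\<^sup>+\<omega>. of_bool (\<exists>j\<in>{..n}. r \<le> norm (W (real j / real n) \<omega>)) \<partial>M) = exit_prob n (sqrt (real n) * r) 0 0"
proof -
  let ?x = "\<lambda>\<omega>. \<lambda>i\<in>{..<n}. increment 1 n i \<omega>" and ?y = "\<lambda>\<omega>. \<lambda>i\<in>{..<n}. increment 2 n i \<omega>"
  let ?P = "PiM {..<n} (\<lambda>_. std_gauss)" and ?B = "PiM {..<n} (\<lambda>_. borel :: real measure)"
  let ?F = "\<lambda>u v. of_bool (walk_exceeds 0 n (sqrt (real n) * r) 0 0 u v) :: ennreal"
  interpret P: prob_space ?P by (intro prob_space_PiM) unfold_locales
  have telescope: "(\<Sum>i\<in>{0..<j}. restrict (\<lambda>i. increment c n i \<omega>) {..<n} i) =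
      sqrt (real n) * W (real j / real n) \<omega> $ c" if "j \<in> {0..n}" "W 0 \<omega> $ c = 0" for j c \<omega>
  proof -
    have "(\<Sum>i\<in>{0..<j}. restrict (\<lambda>i. increment c n i \<omega>) {..<n} i) = (\<Sum>i<j. increment c n i \<omega>)"
      using that by (intro sum.cong) auto
    also have "\<dots> = sqrt (real n) * (\<Sum>i<j. W (real (Suc i) / real n) \<omega> $ c - W (real i / real n) \<omega> $ c)"
      by (simp only: sum_distrib_left)
    also have "\<dots> = sqrt (real n) * W (real j / real n) \<omega> $ c"
      using that(2) by (subst sum_lessThan_telescope) simp
    finally show ?thesis .
  qed
  \<comment> \<open>Telescoping needs the path to start at 0, which holds only almost
    surely.\<close>
  have "AE \<omega> in M. of_bool (\<exists>j\<in>{..n}. r \<le> norm (W (real j / real n) \<omega>)) = ?F (?x \<omega>) (?y \<omega>)"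
    using X.start_zero Y.start_zero
  proof eventually_elim
    case (elim \<omega>)
    have "r \<le> norm (W (real j / real n) \<omega>) \<longleftrightarrow>
        sqrt (real n) * r \<le> sqrt ((0 + (\<Sum>i\<in>{0..<j}. ?x \<omega> i))\<^sup>2 + (0 + (\<Sum>i\<in>{0..<j}. ?y \<omega> i))\<^sup>2)"
      if "j \<in> {0..n}" for j
    proof -
      have "sqrt ((0 + (\<Sum>i\<in>{0..<j}. ?x \<omega> i))\<^sup>2 + (0 + (\<Sum>i\<in>{0..<j}. ?y \<omega> i))\<^sup>2) =
          sqrt (real n) * norm (W (real j / real n) \<omega>)"
        unfolding telescope[OF that elim(1)] telescope[OF that elim(2)] norm_W
        by (simp add: power_mult_distrib real_sqrt_mult flip: distrib_left)
      then show ?thesis using n by simp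
    qed
    then have "(\<exists>j\<in>{..n}. r \<le> norm (W (real j / real n) \<omega>)) \<longleftrightarrow> walk_exceeds 0 n (sqrt (real n) * r) 0 0 (?x \<omega>) (?y \<omega>)"
      unfolding atLeast0AtMost[symmetric] by (intro bex_cong refl)
    then show ?case by (simp only:)
  qed
  then have "(\<integral>\<^sup>+\<omega>. of_bool (\<exists>j\<in>{..n}. r \<le> norm (W (real j / real n) \<omega>)) \<partial>M) = (\<integral>\<^sup>+\<omega>. ?F (?x \<omega>) (?y \<omega>) \<partial>M)"
    by (rule nn_integral_cong_AE)
  have Fm: "(\<lambda>w. ?F (fst w) (snd w)) \<in> borel_measurable (?P \<Otimes>\<^sub>M ?P)"
    by (intro borel_measurable_of_bool measurable_walk_exceeds measurable_const)
       (simp_all add: lessThan_atLeast0[symmetric])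
  have sets_eq: "sets (?B \<Otimes>\<^sub>M ?B) = sets (?P \<Otimes>\<^sub>M ?P)"
    by (intro sets_pair_measure_cong sets_PiM_cong) auto
  note \<open>(\<integral>\<^sup>+\<omega>. of_bool _ \<partial>M) = _\<close>
  also have "(\<integral>\<^sup>+\<omega>. ?F (?x \<omega>) (?y \<omega>) \<partial>M) =
      (\<integral>\<^sup>+w. ?F (fst w) (snd w) \<partial>distr M (?B \<Otimes>\<^sub>M ?B) (\<lambda>\<omega>. (?x \<omega>, ?y \<omega>)))"
    using Fm random_variable_increments[OF n]
    by (subst nn_integral_distr) (simp_all cong: measurable_cong_sets add: sets_eq)
  also have "\<dots> = (\<integral>\<^sup>+w. ?F (fst w) (snd w) \<partial>(?P \<Otimes>\<^sub>M ?P))"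
    unfolding distr_increment_pair[OF n] ..
  also have "\<dots> = (\<integral>\<^sup>+u. \<integral>\<^sup>+v. ?F u v \<partial>?P \<partial>?P)"
    using P.nn_integral_fst[OF Fm] by simp
  also have "\<dots> = exit_prob n (sqrt (real n) * r) 0 0"
    using exit_prob_eq_PiM[of 0 n "sqrt (real n) * r" 0 0] by (simp add: lessThan_atLeast0)
  finally show ?thesis .
qed

text \<open>Layer cake formula for the grid maximum, followed by rescaling the radius by
  \<open>sqrt n\<close>.\<close>

lemma expected_grid_max:
  assumes n: "0 < n"
  shows "(\<integral>\<^sup>+\<omega>. ennreal (MAX j\<in>{..n}. norm (W (real j / real n) \<omega>)) \<partial>M) =
    ennreal (1 / sqrt (real n)) * expected_max n"
proof -
  interpret P: pair_sigma_finite M "lborel :: real measure" ..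
  let ?m = "\<lambda>\<omega>. MAX j\<in>{..n}. norm (W (real j / real n) \<omega>)"
  let ?G = "\<lambda>r \<omega>. of_bool (\<exists>j\<in>{..n}. r \<le> norm (W (real j / real n) \<omega>)) :: ennreal"
  have meas: "(\<lambda>w. ?G (snd w) (fst w)) \<in> borel_measurable (M \<Otimes>\<^sub>M lborel)"
    by (intro borel_measurable_of_bool pred_intros_finite(4)) measurable
  have layer: "ennreal (?m \<omega>) = (\<integral>\<^sup>+r. ?G r \<omega> * indicator {0<..} r \<partial>lborel)" for \<omega>
  proof -
    have "0 \<le> ?m \<omega>"
      by (rule order_trans[OF norm_ge_zero Max_ge]) auto
    then have "ennreal (?m \<omega>) = (\<integral>\<^sup>+r. indicator {0<..?m \<omega>} r \<partial>lborel)"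
      by simp
    also have "\<dots> = (\<integral>\<^sup>+r. ?G r \<omega> * indicator {0<..} r \<partial>lborel)"
      by (intro nn_integral_cong) (auto simp: Max_ge_iff split: split_indicator)
    finally show ?thesis .
  qed
  have "(\<integral>\<^sup>+\<omega>. ennreal (?m \<omega>) \<partial>M) = (\<integral>\<^sup>+\<omega>. \<integral>\<^sup>+r. ?G r \<omega> * indicator {0<..} r \<partial>lborel \<partial>M)"
    unfolding layer ..
  also have "\<dots> = (\<integral>\<^sup>+r. \<integral>\<^sup>+\<omega>. ?G r \<omega> * indicator {0<..} r \<partial>M \<partial>lborel)"
    using meas by (intro P.Fubini'[symmetric]) (simp add: split_beta')
  also have "\<dots> = (\<integral>\<^sup>+r. (\<integral>\<^sup>+\<omega>. ?G r \<omega> \<partial>M) * indicator {0<..} r \<partial>lborel)"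
  proof (intro nn_integral_cong nn_integral_multc)
    show "?G r \<in> borel_measurable M" for r
      by (intro borel_measurable_of_bool pred_intros_finite(4)) measurable
  qed
  also have "\<dots> = (\<integral>\<^sup>+r. exit_prob n (sqrt (real n) * r) 0 0 * indicator {0<..} (sqrt (real n) * r) \<partial>lborel)"
    unfolding prob_grid_exceeds[OF n] using n
    by (intro nn_integral_cong) (simp add: zero_less_mult_iff split: split_indicator)
  also have "\<dots> = ennreal (1 / sqrt (real n)) * (ennreal (sqrt (real n)) *
      (\<integral>\<^sup>+r. exit_prob n (0 + sqrt (real n) * r) 0 0 * indicator {0<..} (0 + sqrt (real n) * r) \<partial>lborel))"
    using n by (simp flip: mult.assoc ennreal_mult)
  also have "ennreal (sqrt (real n)) *
      (\<integral>\<^sup>+r. exit_prob n (0 + sqrt (real n) * r) 0 0 * indicator {0<..} (0 + sqrt (real n) * r) \<partial>lborel) = expected_max n"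
    unfolding expected_max_def using n
    by (subst (2) nn_integral_real_affine[where c = "sqrt (real n)" and t = 0]) auto
  finally show ?thesis .
qed

end

section \<open>The lower limit of the normalized expected maxima\<close>

text \<open>Any value strictly below the lower limit is eventually a growth constant, to which the
  Abelian argument applies.\<close>

lemma liminf_expected_max_le:
  "liminf (\<lambda>n. ennreal (1 / sqrt (real n)) * expected_max n) \<le>
    ennreal (sqrt 2 * (LBINT r:{0<..}. 1 / bessel_I 0 r) / Gamma (1 / 2))"
proof (rule dense_le)
  let ?K = "LBINT r:{0<..}. 1 / bessel_I 0 r"
  have K: "0 \<le> ?K" by (rule set_integral_inverse_bessel_I_0_nonneg)
  have sum_le: "ennreal (1 - exp (- a)) * (\<Sum>n<N. ennreal (exp (- a) ^ n) * expected_max n) \<le> ennreal (?K / sqrt (2 * a))"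
    if "0 < a" for a N
    \<comment> \<open>The choice l = sqrt (2 a) makes l^2 / 2 equal to \<open>a\<close>.\<close>
    using sum_expected_max_le[of "sqrt (2 * a)" N] that by simp
  \<comment> \<open>One infinite term would already violate the bound for a = 1.\<close>
  have finite: "expected_max n < \<top>" for n
  proof (rule ccontr)
    assume "\<not> expected_max n < \<top>"
    then have top: "expected_max n = \<top>" using less_top by blast
    have "ennreal (exp (- 1) ^ n) * expected_max n \<le> (\<Sum>n<Suc n. ennreal (exp (- 1) ^ n) * expected_max n)"
      by (rule member_le_sum) auto
    then have "ennreal (1 - exp (- 1)) * (ennreal (exp (- 1) ^ n) * expected_max n) \<le> ennreal (?K / sqrt (2 * 1))"
      by (rule order_trans[OF mult_left_mono sum_le[of 1]]) simp_all
    then show False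
      by (simp add: top ennreal_mult_top top_unique)
  qed
  define d where "d n = enn2real (expected_max n)" for n
  have d: "expected_max n = ennreal (d n)" for n
    using finite[of n] by (simp add: d_def)
  have d_nonneg: "0 \<le> d n" for n by (simp add: d_def)
  have bound: "(1 - exp (- a)) * (\<Sum>n<N. exp (- a) ^ n * d n) \<le> ?K / sqrt (2 * a)" if a: "0 < a" for a N
  proof -
    have "ennreal ((1 - exp (- a)) * (\<Sum>n<N. exp (- a) ^ n * d n)) =
        ennreal (1 - exp (- a)) * (\<Sum>n<N. ennreal (exp (- a) ^ n) * expected_max n)"
      using a d_nonneg by (simp add: d ennreal_mult sum_nonneg flip: sum_ennreal)
    also have "\<dots> \<le> ennreal (?K / sqrt (2 * a))" by (rule sum_le[OF a])
    finally show ?thesis using K a by (subst (asm) ennreal_le_iff) auto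
  qed
  fix x assume x: "x < liminf (\<lambda>n. ennreal (1 / sqrt (real n)) * expected_max n)"
  then have "x < \<top>" by (rule less_le_trans) simp
  then obtain c where c: "x = ennreal c" "0 \<le> c" by (cases x) auto
  show "x \<le> ennreal (sqrt 2 * ?K / Gamma (1 / 2))"
  proof (cases "c = 0")
    case False
    have "\<forall>\<^sub>F n in sequentially. x < ennreal (1 / sqrt (real n)) * expected_max n"
      by (rule less_LiminfD[OF x])
    then obtain m where m: "ennreal c < ennreal (1 / sqrt (real n)) * ennreal (d n)" if "m \<le> n" for n
      unfolding eventually_sequentially c d by blast
    have growth: "c * sqrt (real n) \<le> d n" if "m \<le> n" for n
    \<comment> \<open>For \<open>n = 0\<close> there is no division by \<open>sqrt n\<close>, but
      the left-hand side is 0.\<close>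
    proof (cases "n = 0")
      case False
      have "ennreal c < ennreal (d n / sqrt (real n))"
        using m[OF that] d_nonneg[of n] by (simp flip: ennreal_mult)
      then have "c < d n / sqrt (real n)" using c(2) by (simp add: ennreal_less_iff)
      then show ?thesis using False by (simp add: pos_less_divide_eq)
    qed (simp add: d_nonneg)
    have "c * Gamma (1 / 2) \<le> sqrt 2 * ?K"
      using False c(2) by (intro sqrt_growth_constant_le[OF d_nonneg bound _ growth]) auto
    then have "c \<le> sqrt 2 * ?K / Gamma (1 / 2)"
      by (simp add: pos_le_divide_eq Gamma_real_pos)
    then show ?thesis unfolding c(1) by (rule ennreal_leI)
  qed (simp add: c)
qed

section \<open>The circumradius of the path\<close>

lemma circumradius_le:
  assumes "0 \<le> r" "A \<subseteq> cball c r"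
  shows "circumradius A \<le> r"
  unfolding circumradius_def
proof (rule cInf_lower)
  show "r \<in> {r. 0 \<le> r \<and> (\<exists>c. A \<subseteq> cball c r)}" using assms by blast
  show "bdd_below {r. 0 \<le> r \<and> (\<exists>c. A \<subseteq> cball c r)}" by (rule bdd_belowI[of _ 0]) simp
qed

text \<open>Boundedness supplies an admissible radius, so the infimum is over a nonempty set of
  nonnegative numbers.\<close>

lemma circumradius_nonneg:
  assumes "bounded A"
  shows "0 \<le> circumradius (A :: 'a::euclidean_space set)"
  unfolding circumradius_def
proof (rule cInf_greatest)
  obtain r where "\<forall>x\<in>A. norm x \<le> r" using assms unfolding bounded_iff by blast
  then have r: "A \<subseteq> cball 0 r" by (simp add: subset_iff)
  have "cball 0 r \<subseteq> cball (0 :: 'a) \<bar>r\<bar>" by (rule subset_cball) simp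
  with r have "A \<subseteq> cball 0 \<bar>r\<bar>" by (rule order_trans)
  then have "\<bar>r\<bar> \<in> {r. 0 \<le> r \<and> (\<exists>c. A \<subseteq> cball c r)}" by (intro CollectI conjI abs_ge_zero exI)
  then show "{r. 0 \<le> r \<and> (\<exists>c. A \<subseteq> cball c r)} \<noteq> {}" by (metis empty_iff)
qed simp

lemma bounded_hull_path:
  "continuous_on {0..1} f \<Longrightarrow> bounded (convex hull (f ` {0..1 :: real}) :: 'a::euclidean_space set)"
  by (intro bounded_convex_hull compact_imp_bounded compact_continuous_image compact_Icc)

text \<open>A disc centred at the origin that contains the path contains its hull. By uniform
  continuity, fine grids see the maximal norm up to any \<open>e\<close>.\<close>

lemma circumradius_hull_le_liminf:
  fixes f :: "real \<Rightarrow> 'a::euclidean_space"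
  assumes f: "continuous_on {0..1} f"
  shows "ennreal (circumradius (convex hull (f ` {0..1}))) \<le>
    liminf (\<lambda>n. ennreal (MAX j\<in>{..n}. norm (f (real j / real n))))"
  unfolding le_Liminf_iff
proof (intro allI impI)
  let ?C = "circumradius (convex hull (f ` {0..1}))" and ?m = "\<lambda>n. MAX j\<in>{..n}. norm (f (real j / real n))"
  fix y assume y: "y < ennreal ?C"
  then have "y < \<top>" by (rule less_le_trans) simp
  then obtain c where c: "y = ennreal c" "0 \<le> c" by (cases y) auto
  have "c < ?C" using y unfolding c(1) using c(2) by (simp add: ennreal_less_iff)
  \<comment> \<open>Half the gap, so that an error \<open>e\<close> keeps the inequality
    strict.\<close>
  define e where "e = (?C - c) / 2"
  have e: "0 < e" "c < ?C - e" using \<open>c < ?C\<close> by (auto simp: e_def field_simps)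
  have "uniformly_continuous_on {0..1} f"
    using f by (intro compact_uniformly_continuous compact_Icc)
  then obtain \<delta> where \<delta>: "0 < \<delta>"
    "\<And>s t. s \<in> {0..1} \<Longrightarrow> t \<in> {0..1} \<Longrightarrow> dist t s < \<delta> \<Longrightarrow> dist (f t) (f s) < e"
    using e(1) unfolding uniformly_continuous_on_def by metis
  have "?C \<le> ?m n + e" if n: "0 < n" "1 / \<delta> < real n" for n
  proof -
    have "norm (f s) \<le> ?m n + e" if s: "s \<in> {0..1}" for s
    proof -
      \<comment> \<open>The last grid point not after \<open>s\<close>, at distance less than
        1/n.\<close>
      define j where "j = nat \<lfloor>s * real n\<rfloor>"
      have j: "real j \<le> s * real n" "s * real n < real j + 1" using s by (auto simp: j_def)
      have "s * real n \<le> real n" using s by (simp add: mult_left_le_one_le)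
      then have jn: "j \<le> n" using j(1) by linarith
      have "real j / real n \<le> s" "s < real j / real n + 1 / real n"
        using j n(1) by (simp_all add: field_simps)
      moreover have "1 / real n < \<delta>" using n \<delta>(1) by (simp add: field_simps)
      ultimately have "dist s (real j / real n) < \<delta>" by (simp add: dist_real_def)
      then have "dist (f s) (f (real j / real n)) < e"
        using s jn by (intro \<delta>(2)) (auto simp: divide_le_eq_1)
      then have "norm (f s) \<le> norm (f (real j / real n)) + e"
        unfolding dist_norm using norm_triangle_sub[of "f s" "f (real j / real n)"] by linarith
      also have "norm (f (real j / real n)) \<le> ?m n"
        using jn by (intro Max_ge) auto
      finally show ?thesis by simp
    qed
    then have "f ` {0..1} \<subseteq> cball 0 (?m n + e)" by auto
    then have "convex hull (f ` {0..1}) \<subseteq> cball 0 (?m n + e)"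
      by (intro hull_minimal) auto
    moreover have "0 \<le> ?m n + e"
      using e(1) by (intro add_nonneg_nonneg order_trans[OF norm_ge_zero Max_ge]) auto
    ultimately show ?thesis by (intro circumradius_le)
  qed
  then have "c < ?m n" if "0 < n" "1 / \<delta> < real n" for n
    using e(2) that by (meson less_le_trans diff_le_eq)
  then have lower: "y < ennreal (?m n)" if "0 < n" "1 / \<delta> < real n" for n
    using that c(2) unfolding c(1) by (intro ennreal_lessI) (auto intro: le_less_trans)
  have "\<forall>\<^sub>F n in sequentially. 1 / \<delta> < real n"
    using filterlim_real_sequentially unfolding filterlim_at_top_dense by blast
  moreover note eventually_gt_at_top[of "0 :: nat"]
  ultimately have "\<forall>\<^sub>F n in sequentially. 1 / \<delta> < real n \<and> 0 < n"
    by (intro eventually_conj)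
  then show "\<forall>\<^sub>F n in sequentially. y < ennreal (?m n)"
    by (rule eventually_mono) (use lower in blast)
qed

text \<open>This reduces measurability to countably many times, centres and margins. The margin
  \<open>1 / real (Suc k)\<close> encodes strictness, and its bound by \<open>a\<close> keeps the
  radius nonnegative.\<close>

lemma circumradius_hull_less_iff:
  fixes f :: "real \<Rightarrow> 'a::euclidean_space"
  assumes f: "continuous_on {0..1} f"
    and T: "T \<subseteq> {0..1}" "{0..1} \<subseteq> closure T"
    and D: "\<And>X. open X \<Longrightarrow> X \<noteq> {} \<Longrightarrow> \<exists>c\<in>D. c \<in> X"
  shows "circumradius (convex hull (f ` {0..1})) < a \<longleftrightarrow>
    (\<exists>c\<in>D. \<exists>k. 1 / real (Suc k) \<le> a \<and> (\<forall>s\<in>T. norm (f s - c) \<le> a - 1 / real (Suc k)))"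
    (is "?C < a \<longleftrightarrow> ?R")
proof
  assume less: "?C < a"
  let ?A = "convex hull (f ` {0..1})"
  \<comment> \<open>One half of the gap pays for moving the centre into \<open>D\<close>, the other
    for the margin.\<close>
  define h where "h = (a - ?C) / 2"
  have C: "0 \<le> ?C" by (intro circumradius_nonneg bounded_hull_path f)
  have h: "0 < h" "?C + h = a - h" using less by (simp_all add: h_def field_simps)
  obtain c0 where c0: "?A \<subseteq> cball c0 ?C"
    using circumradius_attained[OF bounded_hull_path[OF f]] by auto
  obtain k where k: "1 / real (Suc k) < h"
    using h(1) by (rule nat_approx_posE)
  obtain c where c: "c \<in> D" "dist c0 c < h"
    using D[of "ball c0 h"] h(1) by auto
  have k': "h + 1 / real (Suc k) \<le> a - ?C"
    using k h(2) by (simp add: h_def field_simps)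
  have "norm (f s - c) \<le> a - 1 / real (Suc k)" if "s \<in> T" for s
  proof -
    have "f s \<in> ?A" using that T(1) by (intro hull_inc) auto
    then have "dist c0 (f s) \<le> ?C" using c0 by auto
    moreover have "norm (f s - c) \<le> dist c0 (f s) + dist c0 c"
      using dist_triangle3[of "f s" c c0] by (simp add: dist_norm)
    ultimately show ?thesis using c(2) k' by simp
  qed
  moreover have "1 / real (Suc k) \<le> a" using k' h(1) C by simp
  ultimately show ?R using c(1) by blast
next
  assume ?R
  then obtain c k where ck: "1 / real (Suc k) \<le> a" "\<And>s. s \<in> T \<Longrightarrow> norm (f s - c) \<le> a - 1 / real (Suc k)"
    by blast
  \<comment> \<open>By continuity the bound extends from the dense set of times to the whole
    interval.\<close>
  have cl: "closure T = {0..1}"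
    using T by (intro antisym closure_minimal) auto
  have "norm (f s - c) \<le> a - 1 / real (Suc k)" if "s \<in> {0..1}" for s
  proof (rule continuous_on_closure_norm_le[where f = "\<lambda>s. f s - c" and s = T and x = s])
    show "continuous_on (closure T) (\<lambda>s. f s - c)"
      unfolding cl by (intro continuous_intros f)
  qed (use ck(2) that cl in auto)
  then have "f ` {0..1} \<subseteq> cball c (a - 1 / real (Suc k))"
    by (auto simp: dist_norm norm_minus_commute)
  then have "convex hull (f ` {0..1}) \<subseteq> cball c (a - 1 / real (Suc k))"
    by (intro hull_minimal) auto
  then have "?C \<le> a - 1 / real (Suc k)" using ck(1) by (intro circumradius_le) auto
  also have "\<dots> < a" by simp
  finally show "?C < a" .
qed

section \<open>Measurability and expectation of the circumradius\<close>

context planar_brownian_motion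
begin

lemma AE_continuous_path: "AE \<omega> in M. continuous_on {0..1} (\<lambda>s. W s \<omega>)"
  using X.continuous_paths Y.continuous_paths
proof eventually_elim
  case (elim \<omega>)
  have "continuous_on {0..1} (\<lambda>s. W s \<omega> $ i)" for i
  proof -
    from exhaust_2[of i] have "continuous_on {0..} (\<lambda>s. W s \<omega> $ i)"
      using elim by (elim disjE) simp_all
    then show ?thesis by (rule continuous_on_subset) simp
  qed
  then have "continuous_on {0..1} (\<lambda>s. \<chi> i. W s \<omega> $ i)"
    by (rule continuous_on_vec_lambda)
  then show ?case by simp
qed

text \<open>The countable description is valid for continuous paths only. The remaining paths lie in
  a null set, all of whose subsets are measurable in the completion.\<close>

lemma borel_measurable_circumradius_hull:
  "(\<lambda>\<omega>. circumradius (convex hull ((\<lambda>s. W s \<omega>) ` {0..1}))) \<in> borel_measurable (completion M)"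
proof -
  obtain T :: "real set" where T: "countable T" "T \<subseteq> {0..1}" "{0..1} \<subseteq> closure T"
    by (rule separable)
  obtain D :: "(real^2) set" where D: "countable D" "\<And>X. open X \<Longrightarrow> X \<noteq> {} \<Longrightarrow> \<exists>c\<in>D. c \<in> X"
    using countable_dense_exists[where 'a = "real^2"] by blast
  let ?C = "\<lambda>\<omega>. circumradius (convex hull ((\<lambda>s. W s \<omega>) ` {0..1}))"
  let ?good = "\<lambda>\<omega>. continuous_on {0..1} (\<lambda>s. W s \<omega>)"
  show ?thesis
  proof (rule borel_measurableI_less)
    fix a :: real
    let ?P = "\<lambda>\<omega>. \<exists>c\<in>D. \<exists>k. 1 / real (Suc k) \<le> a \<and> (\<forall>s\<in>T. norm (W s \<omega> - c) \<le> a - 1 / real (Suc k))"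
    have ball: "Measurable.pred M (\<lambda>\<omega>. norm (W s \<omega> - c) \<le> b)" if "s \<in> T" for s c b
    proof -
      have "0 \<le> s" using that T(2) by auto
      have norm_eq: "norm (W s \<omega> - c) = sqrt ((W s \<omega> $ 1 - c $ 1)\<^sup>2 + (W s \<omega> $ 2 - c $ 2)\<^sup>2)" for \<omega>
        by (simp add: norm_vec_def L2_set_def UNIV_2)
      note [measurable] = borel_measurable_W[OF \<open>0 \<le> s\<close>]
      show ?thesis unfolding norm_eq by measurable
    qed
    have "Measurable.pred M ?P"
      unfolding pred_def
      by (intro sets.sets_Collect_countable_Ex' sets.sets_Collect_countable_Ex sets.sets_Collect_conj
          sets.sets_Collect_countable_All' sets.sets_Collect_const D(1) T(1) ball[unfolded pred_def])
    then have [measurable]: "Measurable.pred (completion M) ?P"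
      by (rule measurable_completion)
    have [measurable]: "Measurable.pred (completion M) (\<lambda>\<omega>. \<not> ?good \<omega> \<and> Q \<omega>)" for Q
      using AE_continuous_path by (intro sets_completion_AE) (auto elim: eventually_mono)
    \<comment> \<open>The conjunct \<open>True\<close> matches the preceding fact for null
      events.\<close>
    have "Measurable.pred (completion M) (\<lambda>\<omega>. (?P \<omega> \<and> \<not> (\<not> ?good \<omega> \<and> True)) \<or> (\<not> ?good \<omega> \<and> ?C \<omega> < a))"
      by measurable
    also have "(\<lambda>\<omega>. (?P \<omega> \<and> \<not> (\<not> ?good \<omega> \<and> True)) \<or> (\<not> ?good \<omega> \<and> ?C \<omega> < a)) = (\<lambda>\<omega>. ?C \<omega> < a)"
      using circumradius_hull_less_iff[OF _ T(2,3) D(2)] by (auto simp: fun_eq_iff)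
    finally show "{\<omega> \<in> space (completion M). ?C \<omega> < a} \<in> sets (completion M)"
      by (simp add: pred_def)
  qed
qed

text \<open>Fatou's lemma along the grids, whose expectations depend only on the Gaussian
  walk.\<close>

lemma nn_integral_circumradius_hull_le:
  "(\<integral>\<^sup>+\<omega>. ennreal (circumradius (convex hull ((\<lambda>s. W s \<omega>) ` {0..1}))) \<partial>M) \<le>
    ennreal (sqrt 2 * (LBINT r:{0<..}. 1 / bessel_I 0 r) / Gamma (1 / 2))"
proof -
  let ?m = "\<lambda>n \<omega>. ennreal (MAX j\<in>{..n}. norm (W (real j / real n) \<omega>))"
  have "(\<integral>\<^sup>+\<omega>. ennreal (circumradius (convex hull ((\<lambda>s. W s \<omega>) ` {0..1}))) \<partial>M) \<le>
      (\<integral>\<^sup>+\<omega>. liminf (\<lambda>n. ?m n \<omega>) \<partial>M)"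
    using AE_continuous_path
    by (intro nn_integral_mono_AE) (auto elim!: eventually_mono intro: circumradius_hull_le_liminf)
  also have "\<dots> \<le> liminf (\<lambda>n. \<integral>\<^sup>+\<omega>. ?m n \<omega> \<partial>M)"
    by (rule nn_integral_liminf) measurable
  also have "\<dots> = liminf (\<lambda>n. ennreal (1 / sqrt (real n)) * expected_max n)"
    by (intro Liminf_eq eventually_mono[OF eventually_gt_at_top[of 0]] expected_grid_max)
  also have "\<dots> \<le> ennreal (sqrt 2 * (LBINT r:{0<..}. 1 / bessel_I 0 r) / Gamma (1 / 2))"
    by (rule liminf_expected_max_le)
  finally show ?thesis .
qed

end

theorem proposition1p3:
  fixes M :: "'a measure" and W :: "real \<Rightarrow> 'a \<Rightarrow> real^2"
    and H :: "'a \<Rightarrow> (real^2) set" and R :: "'a \<Rightarrow> real"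
  assumes "planar_brownian_motion M W"
    and H: "\<And>\<omega>. H \<omega> = convex hull ((\<lambda>s. W s \<omega>) ` {0..1})"
    and R: "\<And>\<omega>. R \<omega> = circumradius (H \<omega>)"
  shows "integrable (completion M) R \<and>
    (LINT \<omega>|completion M. R \<omega>) \<le>
      inverse (Gamma (1 / 2)) *
        (LBINT t:{0<..}. t powr (- 1 / 2) / bessel_I 0 (sqrt (2 * t)))"
proof -
  interpret planar_brownian_motion M W by fact
  let ?K = "LBINT r:{0<..}. 1 / bessel_I 0 r"
  have K: "0 \<le> ?K" by (rule set_integral_inverse_bessel_I_0_nonneg)
  have R_eq: "R = (\<lambda>\<omega>. circumradius (convex hull ((\<lambda>s. W s \<omega>) ` {0..1})))"
    by (rule ext) (simp add: R H)
  have meas: "R \<in> borel_measurable (completion M)"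
    unfolding R_eq by (rule borel_measurable_circumradius_hull)
  \<comment> \<open>Only almost surely: an unbounded path would give the infimum of an empty
    set.\<close>
  have nonneg: "AE \<omega> in completion M. 0 \<le> R \<omega>"
    unfolding R_eq AE_completion_iff
    using AE_continuous_path by eventually_elim (intro circumradius_nonneg bounded_hull_path)
  have le: "(\<integral>\<^sup>+\<omega>. ennreal (R \<omega>) \<partial>completion M) \<le> ennreal (sqrt 2 * ?K / Gamma (1 / 2))"
    unfolding nn_integral_completion unfolding R_eq by (rule nn_integral_circumradius_hull_le)
  \<comment> \<open>The finite bound makes the nonnegative integral a real number, which yields
    integrability.\<close>
  then obtain x where x: "(\<integral>\<^sup>+\<omega>. ennreal (R \<omega>) \<partial>completion M) = ennreal x" "0 \<le> x"
    by (cases "\<integral>\<^sup>+\<omega>. ennreal (R \<omega>) \<partial>completion M") (auto simp: top_unique)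
  have int: "integrable (completion M) R"
    by (rule integrableI_nn_integral_finite[OF meas nonneg x(1)])
  have "(LINT \<omega>|completion M. R \<omega>) = x"
    using integral_eq_nn_integral[OF meas nonneg] x by simp
  also have "x \<le> sqrt 2 * ?K / Gamma (1 / 2)"
    using le K unfolding x(1) by (simp add: Gamma_real_nonneg)
  also have "\<dots> = inverse (Gamma (1 / 2)) *
      (LBINT t:{0<..}. t powr (- 1 / 2) / bessel_I 0 (sqrt (2 * t)))"
    unfolding set_integral_bessel_substitution by (simp only: divide_inverse mult.commute)
  finally show ?thesis using int by blast
qed

end
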